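(* Let $G$ be a profinite group with $\mathfrak{g}_1\cong(\mathbb{Z}/n)^I$ for some index set $I$. Let $u\in H^1(G^{(2)},\Lambda)^{\mathfrak{g}_1}$ and let $\eta=d_2u\in H^2(\mathfrak{g}_1,\Lambda)$. Choose finitely many $x_i,y_i,z_j\in\mathfrak{K}$ with $\eta=\sum_i x_i\cup y_i+\sum_j\beta z_j$. Then for all $\sigma,\tau\in\mathfrak{g}_1$: (1) $-u([\sigma,\tau])=\sum_i\big(\sigma(x_i)\tau(y_i)-\sigma(y_i)\tau(x_i)\big)$; (2) $-u(\sigma^\pi)=\binom n2\sum_i\sigma(x_i)\sigma(y_i)+\sum_j\sigma(z_j)$, where $u$ is regarded as a homomorphism $\mathfrak{g}_2\to\Lambda$.
   Context: $n\ge1$, $\Lambda=\mathbb{Z}/n$; maps continuous, cohomology continuous with trivial coefficients. $G^{(1)}=G$, $G^{(i+1)}=[G,G^{(i)}](G^{(i)})^n$, $\mathfrak{g}_i=G^{(i)}/G^{(i+1)}$ (additive). For $\sigma,\tau\in\mathfrak{g}_1$ with lifts $\tilde\sigma,\tilde\tau\in G/G^{(3)}$: $[\sigma,\tau]=\tilde\sigma^{-1}\tilde\tau^{-1}\tilde\sigma\tilde\tau\in\mathfrak{g}_2$, $\sigma^\pi=\tilde\sigma^n\in\mathfrak{g}_2$. $H^1(G^{(2)},\Lambda)^{\mathfrak{g}_1}$ is the group of continuous homomorphisms $G^{(2)}\to\Lambda$ invariant under $G$-conjugation; these vanish on $G^{(3)}$, hence define homomorphisms $\mathfrak{g}_2\to\Lambda$.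 $d_2:H^1(G^{(2)})^{\mathfrak{g}_1}\to H^2(\mathfrak{g}_1)$ is the differential $d_2^{0,1}$ of the Lyndon–Hochschild–Serre spectral sequence of $G\to\mathfrak{g}_1$. $\mathfrak{K}=H^1(\mathfrak{g}_1,\Lambda)$, and $\sigma(x)$ denotes evaluation of $x\in\mathfrak{K}$ at $\sigma\in\mathfrak{g}_1$. $x\cup y$ is represented by $(\sigma,\tau)\mapsto x(\sigma)y(\tau)$; $\beta$ is the Bockstein (connecting map of $0\to\mathbb{Z}/n\xrightarrow{n}\mathbb{Z}/n^2\to\mathbb{Z}/n\to0$). Every element of $H^2(\mathfrak{g}_1,\Lambda)$ can be written in the form $\sum_i x_i\cup y_i+\sum_j\beta z_j$. *)

theory Defs
  imports
    "HOL-Analysis.Analysis"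
    "HOL-Algebra.FiniteProduct"
    "HOL-Algebra.Generated_Groups"
    "HOL-Algebra.Product_Groups"
    "HOL-Algebra.Elementary_Groups"
    "HOL-Number_Theory.Cong"
begin

section \<open>Profinite groups\<close>

text \<open>A topological group is a group \<open>G\<close> together with a topology \<open>T\<close> on its carrier.\<close>

definition topological_group :: "'a monoid \<Rightarrow> 'a topology \<Rightarrow> bool" where
  "topological_group G T \<longleftrightarrow>
     group G \<and> topspace T = carrier G \<and>
     continuous_map (prod_topology T T) T (\<lambda>(g, h). g \<otimes>\<^bsub>G\<^esub> h) \<and>
     continuous_map T T (\<lambda>g. inv\<^bsub>G\<^esub> g)"

definition profinite_group :: "'a monoid \<Rightarrow> 'a topology \<Rightarrow> bool" where
  "profinite_group G T \<longleftrightarrow>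
     topological_group G T \<and> compact_space T \<and> Hausdorff_space T \<and>
     (\<forall>S. connectedin T S \<longrightarrow> (\<exists>g. S \<subseteq> {g}))"

definition quot_topology :: "'a monoid \<Rightarrow> 'a topology \<Rightarrow> 'a set \<Rightarrow> 'a set topology" where
  "quot_topology G T N =
     topology (\<lambda>U. U \<subseteq> (\<lambda>g. N #>\<^bsub>G\<^esub> g) ` topspace T \<and>
                   openin T {g \<in> topspace T. N #>\<^bsub>G\<^esub> g \<in> U})"

lemma openin_quot_topology:
  "openin (quot_topology G T N) U \<longleftrightarrow>
     U \<subseteq> (\<lambda>g. N #>\<^bsub>G\<^esub> g) ` topspace T \<and> openin T {g \<in> topspace T. N #>\<^bsub>G\<^esub> g \<in> U}"
proof -
  let ?q = "\<lambda>g. N #>\<^bsub>G\<^esub> g"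
  let ?L = "\<lambda>U. U \<subseteq> ?q ` topspace T \<and> openin T {g \<in> topspace T. ?q g \<in> U}"
  have "istopology ?L"
    unfolding istopology_def
  proof (intro conjI allI impI)
    fix S S' assume "?L S" "?L S'"
    moreover have "{g \<in> topspace T. ?q g \<in> S \<inter> S'}
        = {g \<in> topspace T. ?q g \<in> S} \<inter> {g \<in> topspace T. ?q g \<in> S'}" by auto
    ultimately show "S \<inter> S' \<subseteq> ?q ` topspace T"
      and "openin T {g \<in> topspace T. ?q g \<in> S \<inter> S'}" by auto
  next
    fix \<K> assume K: "\<forall>S\<in>\<K>. ?L S"
    then show "\<Union>\<K> \<subseteq> ?q ` topspace T" by blast
    have "{g \<in> topspace T. ?q g \<in> \<Union>\<K>} = (\<Union>S\<in>\<K>. {g \<in> topspace T. ?q g \<in> S})" by auto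
    with K show "openin T {g \<in> topspace T. ?q g \<in> \<Union>\<K>}" by auto
  qed
  then show ?thesis
    by (simp add: quot_topology_def topology_inverse')
qed

lemma topspace_quot_topology:
  "topspace (quot_topology G T N) = (\<lambda>g. N #>\<^bsub>G\<^esub> g) ` topspace T" (is "_ = ?Q")
proof
  show "topspace (quot_topology G T N) \<subseteq> ?Q"
    using openin_quot_topology openin_topspace by metis
  have "{g \<in> topspace T. N #>\<^bsub>G\<^esub> g \<in> ?Q} = topspace T" by auto
  then have "openin (quot_topology G T N) ?Q"
    by (simp add: openin_quot_topology)
  then show "?Q \<subseteq> topspace (quot_topology G T N)"
    by (rule openin_subset)
qed

lemma quotient_map_quot_topology: "quotient_map T (quot_topology G T N) (\<lambda>g. N #>\<^bsub>G\<^esub> g)"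
  by (simp add: quotient_map_def topspace_quot_topology openin_quot_topology)


section \<open>The series \<open>G\<^sup>(\<^sup>i\<^sup>)\<close> and the operations on its graded pieces\<close>

text \<open>
  As usual for profinite groups, the subgroup \<open>[G, H] H\<^sup>n\<close> is the closed subgroup
  topologically generated by the commutators and \<open>n\<close>-th powers.
  Indexing starts at \<open>1\<close>: \<open>nseries G T n 1 = carrier G\<close>.
\<close>

definition nseries_step :: "'a monoid \<Rightarrow> 'a topology \<Rightarrow> nat \<Rightarrow> 'a set \<Rightarrow> 'a set" where
  "nseries_step G T n H =
     T closure_of generate G
       ({inv\<^bsub>G\<^esub> g \<otimes>\<^bsub>G\<^esub> inv\<^bsub>G\<^esub> h \<otimes>\<^bsub>G\<^esub> g \<otimes>\<^bsub>G\<^esub> h | g h. g \<in> carrier G \<and> h \<in> H}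
        \<union> {h [^]\<^bsub>G\<^esub> n | h. h \<in> H})"

definition nseries :: "'a monoid \<Rightarrow> 'a topology \<Rightarrow> nat \<Rightarrow> nat \<Rightarrow> 'a set" where
  "nseries G T n i = (nseries_step G T n ^^ (i - 1)) (carrier G)"

definition gr1 :: "'a monoid \<Rightarrow> 'a topology \<Rightarrow> nat \<Rightarrow> 'a set monoid" where
  "gr1 G T n = G Mod nseries G T n 2"

definition gr1_top :: "'a monoid \<Rightarrow> 'a topology \<Rightarrow> nat \<Rightarrow> 'a set topology" where
  "gr1_top G T n = quot_topology G T (nseries G T n 2)"

text \<open>
  The lifts to \<open>G/G\<^sup>(\<^sup>3\<^sup>)\<close> of \<open>\<sigma> \<in> G/G\<^sup>(\<^sup>2\<^sup>)\<close>: the canonical projection sends a coset of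
  \<open>G\<^sup>(\<^sup>3\<^sup>)\<close> to the unique coset of \<open>G\<^sup>(\<^sup>2\<^sup>)\<close> that contains it.
\<close>

definition gr1_lifts :: "'a monoid \<Rightarrow> 'a topology \<Rightarrow> nat \<Rightarrow> 'a set \<Rightarrow> 'a set set" where
  "gr1_lifts G T n \<sigma> = {s \<in> carrier (G Mod nseries G T n 3). s \<subseteq> \<sigma>}"

text \<open>
  The bracket and the power operation do not depend on the chosen lifts, so the sets of all
  their possible values below are singletons.  Their values are cosets of \<open>G\<^sup>(\<^sup>3\<^sup>)\<close> in \<open>G\<^sup>(\<^sup>2\<^sup>)\<close>.
\<close>

definition gr_bracket :: "'a monoid \<Rightarrow> 'a topology \<Rightarrow> nat \<Rightarrow> 'a set \<Rightarrow> 'a set \<Rightarrow> 'a set" where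
  "gr_bracket G T n \<sigma> \<tau> =
     (let Q = G Mod nseries G T n 3 in
      the_elem {inv\<^bsub>Q\<^esub> s \<otimes>\<^bsub>Q\<^esub> inv\<^bsub>Q\<^esub> t \<otimes>\<^bsub>Q\<^esub> s \<otimes>\<^bsub>Q\<^esub> t | s t.
                  s \<in> gr1_lifts G T n \<sigma> \<and> t \<in> gr1_lifts G T n \<tau>})"

definition gr_pi :: "'a monoid \<Rightarrow> 'a topology \<Rightarrow> nat \<Rightarrow> 'a set \<Rightarrow> 'a set" where
  "gr_pi G T n \<sigma> =
     (let Q = G Mod nseries G T n 3 in
      the_elem {s [^]\<^bsub>Q\<^esub> n | s. s \<in> gr1_lifts G T n \<sigma>})"

definition iso_to_power :: "'a monoid \<Rightarrow> 'a topology \<Rightarrow> nat \<Rightarrow> 'i set \<Rightarrow> bool" where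
  "iso_to_power H S n I \<longleftrightarrow>
     (\<exists>\<phi>. \<phi> \<in> iso H (product_group I (\<lambda>_. integer_mod_group n)) \<and>
          homeomorphic_map S
            (product_topology (\<lambda>_. discrete_topology (carrier (integer_mod_group n))) I) \<phi>)"


section \<open>Continuous cohomology with coefficients in \<open>\<int>/m\<close> (trivial action)\<close>

text \<open>
  Residues modulo \<open>m\<close> are represented by the integers in \<open>{0..<m}\<close>, as in
  \<^term>\<open>integer_mod_group m\<close>.
\<close>

definition zmod_top :: "nat \<Rightarrow> int topology" where
  "zmod_top m = discrete_topology (carrier (integer_mod_group m))"

definition cont_hom :: "'a monoid \<Rightarrow> 'a topology \<Rightarrow> nat \<Rightarrow> ('a \<Rightarrow> int) set" where
  "cont_hom G T m = {x \<in> hom G (integer_mod_group m). continuous_map T (zmod_top m) x}"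

definition tuples :: "'a monoid \<Rightarrow> nat \<Rightarrow> (nat \<Rightarrow> 'a) set" where
  "tuples G k = (\<Pi>\<^sub>E i\<in>{..<k}. carrier G)"

definition cochains :: "'a monoid \<Rightarrow> 'a topology \<Rightarrow> nat \<Rightarrow> nat \<Rightarrow> ((nat \<Rightarrow> 'a) \<Rightarrow> int) set" where
  "cochains G T m k =
     {f \<in> tuples G k \<rightarrow>\<^sub>E carrier (integer_mod_group m).
        continuous_map (product_topology (\<lambda>_. T) {..<k}) (zmod_top m) f}"

definition cochain_group ::
  "'a monoid \<Rightarrow> 'a topology \<Rightarrow> nat \<Rightarrow> nat \<Rightarrow> ((nat \<Rightarrow> 'a) \<Rightarrow> int) monoid" where
  "cochain_group G T m k =
     (product_group (tuples G k) (\<lambda>_. integer_mod_group m))\<lparr>carrier := cochains G T m k\<rparr>"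

text \<open>With tuples indexed from \<open>0\<close>, the entries \<open>x i\<close> and \<open>x (i + 1)\<close> are multiplied.\<close>

definition merge_at :: "'a monoid \<Rightarrow> nat \<Rightarrow> nat \<Rightarrow> (nat \<Rightarrow> 'a) \<Rightarrow> (nat \<Rightarrow> 'a)" where
  "merge_at G k i x =
     (\<lambda>j\<in>{..<k}. if j < i then x j else if j = i then x i \<otimes>\<^bsub>G\<^esub> x (Suc i) else x (Suc j))"

definition cobd ::
  "'a monoid \<Rightarrow> nat \<Rightarrow> nat \<Rightarrow> ((nat \<Rightarrow> 'a) \<Rightarrow> int) \<Rightarrow> ((nat \<Rightarrow> 'a) \<Rightarrow> int)" where
  "cobd G m k f =
     (\<lambda>x\<in>tuples G (Suc k).
        (f (\<lambda>j\<in>{..<k}. x (Suc j))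
         + (\<Sum>i<k. (-1) ^ Suc i * f (merge_at G k i x))
         + (-1) ^ Suc k * f (restrict x {..<k})) mod int m)"

definition cocycles :: "'a monoid \<Rightarrow> 'a topology \<Rightarrow> nat \<Rightarrow> nat \<Rightarrow> ((nat \<Rightarrow> 'a) \<Rightarrow> int) set" where
  "cocycles G T m k =
     {f \<in> cochains G T m k. cobd G m k f = \<one>\<^bsub>cochain_group G T m (Suc k)\<^esub>}"

definition coboundaries :: "'a monoid \<Rightarrow> 'a topology \<Rightarrow> nat \<Rightarrow> nat \<Rightarrow> ((nat \<Rightarrow> 'a) \<Rightarrow> int) set" where
  "coboundaries G T m k =
     (case k of 0 \<Rightarrow> {\<one>\<^bsub>cochain_group G T m 0\<^esub>} | Suc j \<Rightarrow> cobd G m j ` cochains G T m j)"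

definition cohomology ::
  "'a monoid \<Rightarrow> 'a topology \<Rightarrow> nat \<Rightarrow> nat \<Rightarrow> ((nat \<Rightarrow> 'a) \<Rightarrow> int) set monoid" where
  "cohomology G T m k =
     (cochain_group G T m k)\<lparr>carrier := cocycles G T m k\<rparr> Mod coboundaries G T m k"

definition coh_class ::
  "'a monoid \<Rightarrow> 'a topology \<Rightarrow> nat \<Rightarrow> nat \<Rightarrow> ((nat \<Rightarrow> 'a) \<Rightarrow> int) \<Rightarrow> ((nat \<Rightarrow> 'a) \<Rightarrow> int) set" where
  "coh_class G T m k c = coboundaries G T m k #>\<^bsub>cochain_group G T m k\<^esub> c"

definition cup11 ::
  "'a monoid \<Rightarrow> 'a topology \<Rightarrow> nat \<Rightarrow> ('a \<Rightarrow> int) \<Rightarrow> ('a \<Rightarrow> int) \<Rightarrow> ((nat \<Rightarrow> 'a) \<Rightarrow> int) set" where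
  "cup11 G T n x y = coh_class G T n 2 (\<lambda>t\<in>tuples G 2. (x (t 0) * y (t 1)) mod int n)"

text \<open>
  The connecting map \<open>H\<^sup>1(G, \<int>/n) \<rightarrow> H\<^sup>2(G, \<int>/n)\<close> of \<open>0 \<rightarrow> \<int>/n \<rightarrow> \<int>/n\<^sup>2 \<rightarrow> \<int>/n \<rightarrow> 0\<close>:
  lift \<open>z\<close> to a continuous cochain \<open>w\<close> with values in \<open>\<int>/n\<^sup>2\<close>; then \<open>dw\<close> is the image \<open>n c\<close> of
  a cochain \<open>c\<close> with values in \<open>\<int>/n\<close>.  As \<open>w\<close> runs through all lifts, \<open>c\<close> runs through exactly
  one cohomology class, so the union below is that class.
\<close>

definition bockstein :: "'a monoid \<Rightarrow> 'a topology \<Rightarrow> nat \<Rightarrow> ('a \<Rightarrow> int) \<Rightarrow> ((nat \<Rightarrow> 'a) \<Rightarrow> int) set" where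
  "bockstein G T n z =
     \<Union>{coh_class G T n 2 c | c w.
          w \<in> cochains G T (n ^ 2) 1 \<and> c \<in> cochains G T n 2 \<and>
          (\<forall>t\<in>tuples G 1. w t mod int n = z (t 0)) \<and>
          (\<forall>t\<in>tuples G 2. (int n * c t) mod int (n ^ 2) = cobd G (n ^ 2) 1 w t)}"


section \<open>The Lyndon--Hochschild--Serre spectral sequence of \<open>G \<rightarrow> G/K\<close>\<close>

text \<open>
  The spectral sequence is that of the Hochschild--Serre filtration \<open>F\<^sup>p\<close> of the complex of
  normalized continuous inhomogeneous cochains of \<open>G\<close>: \<open>F\<^sup>p\<close> in degree \<open>k\<close> is everything for
  \<open>p \<le> 0\<close>, zero for \<open>p > k\<close>, and otherwise consists of the cochains depending on the last \<open>p\<close>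
  of their \<open>k\<close> arguments only modulo \<open>K\<close>.
\<close>

definition hs_filtration ::
  "'a monoid \<Rightarrow> 'a topology \<Rightarrow> nat \<Rightarrow> 'a set \<Rightarrow> int \<Rightarrow> nat \<Rightarrow> ((nat \<Rightarrow> 'a) \<Rightarrow> int) set" where
  "hs_filtration G T m K p k =
     {f \<in> cochains G T m k.
        (\<forall>x\<in>tuples G k. (\<exists>i<k. x i = \<one>\<^bsub>G\<^esub>) \<longrightarrow> f x = 0) \<and>
        (if p > int k then f = \<one>\<^bsub>cochain_group G T m k\<^esub>
         else \<forall>x\<in>tuples G k. \<forall>y\<in>tuples G k.
                (\<forall>i<k. if i < k - nat p then x i = y i
                       else K #>\<^bsub>G\<^esub> x i = K #>\<^bsub>G\<^esub> y i) \<longrightarrow> f x = f y)}"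

text \<open>
  The pages of the spectral sequence of a filtered complex, indexed by the filtration degree \<open>p\<close>
  and the total degree \<open>k = p + q\<close>:
  \<open>E\<^sub>r\<^sup>p\<^sup>,\<^sup>q = Z\<^sub>r\<^sup>p / (Z\<^sub>r\<^sub>-\<^sub>1\<^sup>p\<^sup>+\<^sup>1 + d Z\<^sub>r\<^sub>-\<^sub>1\<^sup>p\<^sup>-\<^sup>r\<^sup>+\<^sup>1)\<close> with \<open>Z\<^sub>r\<^sup>p = {f \<in> F\<^sup>p. d f \<in> F\<^sup>p\<^sup>+\<^sup>r}\<close>,
  where the second summand of the denominator comes from total degree \<open>k - 1\<close>.
\<close>

definition hs_Z ::
  "'a monoid \<Rightarrow> 'a topology \<Rightarrow> nat \<Rightarrow> 'a set \<Rightarrow> int \<Rightarrow> int \<Rightarrow> nat \<Rightarrow> ((nat \<Rightarrow> 'a) \<Rightarrow> int) set" where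
  "hs_Z G T m K r p k =
     {f \<in> hs_filtration G T m K p k. cobd G m k f \<in> hs_filtration G T m K (p + r) (Suc k)}"

definition hs_B ::
  "'a monoid \<Rightarrow> 'a topology \<Rightarrow> nat \<Rightarrow> 'a set \<Rightarrow> int \<Rightarrow> int \<Rightarrow> nat \<Rightarrow> ((nat \<Rightarrow> 'a) \<Rightarrow> int) set" where
  "hs_B G T m K r p k =
     hs_Z G T m K (r - 1) (p + 1) k <#>\<^bsub>cochain_group G T m k\<^esub>
       (case k of 0 \<Rightarrow> {\<one>\<^bsub>cochain_group G T m 0\<^esub>}
                | Suc j \<Rightarrow> cobd G m j ` hs_Z G T m K (r - 1) (p - r + 1) j)"

definition hs_E ::
  "'a monoid \<Rightarrow> 'a topology \<Rightarrow> nat \<Rightarrow> 'a set \<Rightarrow> int \<Rightarrow> int \<Rightarrow> nat \<Rightarrow> ((nat \<Rightarrow> 'a) \<Rightarrow> int) set monoid" where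
  "hs_E G T m K r p k =
     (cochain_group G T m k)\<lparr>carrier := hs_Z G T m K r p k\<rparr> Mod hs_B G T m K r p k"

text \<open>
  The differential out of \<open>E\<^sub>r\<^sup>p\<^sup>,\<^sup>q\<close>, \<open>k = p + q\<close>, sends the class of \<open>f\<close> to the class of \<open>d f\<close>,
  with no extra sign.
\<close>

definition hs_d ::
  "'a monoid \<Rightarrow> 'a topology \<Rightarrow> nat \<Rightarrow> 'a set \<Rightarrow> int \<Rightarrow> int \<Rightarrow> nat \<Rightarrow>
     ((nat \<Rightarrow> 'a) \<Rightarrow> int) set \<Rightarrow> ((nat \<Rightarrow> 'a) \<Rightarrow> int) set" where
  "hs_d G T m K r p k e =
     hs_B G T m K r (p + r) (Suc k) <#>\<^bsub>cochain_group G T m (Suc k)\<^esub> (cobd G m k ` e)"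

definition inflation ::
  "'a monoid \<Rightarrow> 'a set \<Rightarrow> nat \<Rightarrow> ((nat \<Rightarrow> 'a set) \<Rightarrow> int) \<Rightarrow> ((nat \<Rightarrow> 'a) \<Rightarrow> int)" where
  "inflation G K k c = (\<lambda>x\<in>tuples G k. c (\<lambda>i\<in>{..<k}. K #>\<^bsub>G\<^esub> x i))"

text \<open>\<open>H\<^sup>1(K, \<int>/m)\<^bsup>G/K\<^esup>\<close>, the conjugation-invariant continuous homomorphisms:\<close>

definition inv_hom :: "'a monoid \<Rightarrow> 'a topology \<Rightarrow> nat \<Rightarrow> 'a set \<Rightarrow> ('a \<Rightarrow> int) set" where
  "inv_hom G T m K =
     {u \<in> cont_hom (G\<lparr>carrier := K\<rparr>) (subtopology T K) m.
        \<forall>g\<in>carrier G. \<forall>h\<in>K. u (inv\<^bsub>G\<^esub> g \<otimes>\<^bsub>G\<^esub> h \<otimes>\<^bsub>G\<^esub> g) = u h}"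

text \<open>
  \<open>d\<^sub>2\<^sup>0\<^sup>,\<^sup>1\<close> as a map \<open>H\<^sup>1(K, \<int>/m)\<^bsup>G/K\<^esup> \<rightarrow> H\<^sup>2(G/K, \<int>/m)\<close>, through the identification of \<open>E\<^sub>2\<^sup>0\<^sup>,\<^sup>1\<close>
  with the source by restriction of cochains to \<open>K\<close>, and of \<open>H\<^sup>2(G/K, \<int>/m)\<close> with \<open>E\<^sub>2\<^sup>2\<^sup>,\<^sup>0\<close> by
  inflation of normalized cocycles.  Since both are bijective, the union below is over
  representatives of one single class.
\<close>

definition lhs_d2 ::
  "'a monoid \<Rightarrow> 'a topology \<Rightarrow> nat \<Rightarrow> 'a set \<Rightarrow> ('a \<Rightarrow> int) \<Rightarrow> ((nat \<Rightarrow> 'a set) \<Rightarrow> int) set" where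
  "lhs_d2 G T m K u =
     \<Union>{coh_class (G Mod K) (quot_topology G T K) m 2 c | c e.
          e \<in> carrier (hs_E G T m K 2 0 1) \<and>
          (\<forall>f\<in>e. \<forall>h\<in>K. f (\<lambda>i\<in>{..<1}. h) = u h) \<and>
          c \<in> cocycles (G Mod K) (quot_topology G T K) m 2 \<and>
          inflation G K 2 c \<in> hs_d G T m K 2 0 1 e}"

text \<open>
  The value on a coset \<open>C\<close> of \<open>G\<^sup>(\<^sup>3\<^sup>)\<close> of a homomorphism on \<open>G\<^sup>(\<^sup>2\<^sup>)\<close> that is trivial on
  \<open>G\<^sup>(\<^sup>3\<^sup>)\<close>, regarded as a homomorphism on \<open>G\<^sup>(\<^sup>2\<^sup>)/G\<^sup>(\<^sup>3\<^sup>)\<close>: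
\<close>

definition on_coset :: "('a \<Rightarrow> int) \<Rightarrow> 'a set \<Rightarrow> int" where
  "on_coset u C = the_elem (u ` C)"

end

theory Submission
  imports Defs
begin

text \<open>
  Write \<open>K = G\<^sup>(\<^sup>2\<^sup>)\<close> and let \<open>c\<close> be the explicit cocycle on \<open>G/K\<close> representing
  \<open>\<Sum>x\<^sub>i \<union> y\<^sub>i + \<Sum>\<beta> z\<^sub>j\<close>, where \<open>\<beta> z\<close> is represented by the carry cocycle
  \<open>(z \<sigma> + z \<tau> - z (\<sigma>\<tau>)) / n\<close> with \<open>z\<close> lifted to \<open>{0..<n}\<close>.  That \<open>c\<close> lies in the class \<open>d\<^sub>2 u\<close> means
  that \<open>u\<close> extends to a map \<open>F\<close> on \<open>G\<close> with \<open>F g + F h = F (g h) + c (gK, hK)\<close> modulo \<open>n\<close>.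
  Comparing \<open>F (g h)\<close> with \<open>F (h g [g, h])\<close> gives \<open>- u [g, h] = c (\<sigma>, \<tau>) - c (\<tau>, \<sigma>)\<close>, in which the
  symmetric carry cocycles cancel.  Iterating the relation along the powers of \<open>g\<close> gives
  \<open>- u (g\<^sup>n) = \<Sum>c (\<sigma>\<^sup>j, \<sigma>)\<close> over \<open>j < n\<close>: the cup products contribute
  \<open>\<Sum>j = n choose 2\<close> times \<open>x \<sigma> * y \<sigma>\<close>, and the carries of \<open>z\<close> telescope to \<open>z \<sigma>\<close>.
\<close>

section \<open>Descending series and lifts\<close>

lemma (in group) r_inv_assoc: "a \<in> carrier G \<Longrightarrow> x \<in> carrier G \<Longrightarrow> a \<otimes> (inv a \<otimes> x) = x"
  by (simp flip: m_assoc)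

lemma (in group) inv_r_assoc: "a \<in> carrier G \<Longrightarrow> x \<in> carrier G \<Longrightarrow> inv a \<otimes> (a \<otimes> x) = x"
  by (simp flip: m_assoc)

lemma (in subgroup) nat_pow_mem: "h \<in> H \<Longrightarrow> h [^] (n::nat) \<in> H"
  by (induction n) auto

lemma continuous_map_topological_group_mult:
  assumes "topological_group G T" "continuous_map X T f" "continuous_map X T g"
  shows "continuous_map X T (\<lambda>x. f x \<otimes>\<^bsub>G\<^esub> g x)"
proof -
  have "continuous_map X (prod_topology T T) (\<lambda>x. (f x, g x))"
    using assms by (intro continuous_map_pairedI) auto
  then have "continuous_map X T ((\<lambda>(g, h). g \<otimes>\<^bsub>G\<^esub> h) \<circ> (\<lambda>x. (f x, g x)))"
    using assms(1) continuous_map_compose unfolding topological_group_def by blast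
  then show ?thesis by (simp add: o_def)
qed

text \<open>Inversion, multiplication and conjugation are continuous and respect \<open>H\<close>,
  and a continuous map sends the closure of a set into the closure of its image. For multiplication,
  the closure of \<open>H \<times> H\<close> is the product of the closures.\<close>

lemma normal_closure_of:
  fixes G (structure)
  assumes top: "topological_group G T" and H: "H \<lhd> G"
  shows "T closure_of H \<lhd> G"
proof -
  interpret normal H G by (rule H)
  have ts: "topspace T = carrier G" and
    cm: "continuous_map (prod_topology T T) T (\<lambda>(g, h). g \<otimes> h)" and
    ci: "continuous_map T T (\<lambda>g. inv g)"
    using top by (auto simp: topological_group_def)
  let ?C = "T closure_of H"
  have HC: "H \<subseteq> ?C" by (simp add: closure_of_subset subset ts)
  have img: "f h \<in> ?C" if "continuous_map T T f" "\<And>h. h \<in> H \<Longrightarrow> f h \<in> H" "h \<in> ?C" for f h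
  proof -
    have "f h \<in> T closure_of (f ` H)"
      using continuous_map_image_closure_subset[OF that(1), of H] that(3) by blast
    also have "\<dots> \<subseteq> ?C" using that(2) by (intro closure_of_mono) blast
    finally show ?thesis .
  qed
  show ?thesis
  proof (rule normal_invI)
    show "subgroup ?C G"
    proof (rule subgroupI)
      show "?C \<subseteq> carrier G" unfolding ts[symmetric] by (rule closure_of_subset_topspace)
      show "?C \<noteq> {}" using HC subgroup.one_closed[OF subgroup_axioms] by blast
      show "inv a \<in> ?C" if "a \<in> ?C" for a
        using img[OF ci _ that] by blast
      show "a \<otimes> b \<in> ?C" if "a \<in> ?C" "b \<in> ?C" for a b
      proof -
        have "(\<lambda>(g, h). g \<otimes> h) (a, b) \<in> T closure_of ((\<lambda>(g, h). g \<otimes> h) ` (H \<times> H))"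
          using continuous_map_image_closure_subset[OF cm, of "H \<times> H"] that
          by (auto simp: closure_of_Times)
        also have "\<dots> \<subseteq> ?C" by (intro closure_of_mono) auto
        finally show ?thesis by simp
      qed
    qed
    show "x \<otimes> h \<otimes> inv x \<in> ?C" if "x \<in> carrier G" "h \<in> ?C" for x h
    proof (rule img[of "\<lambda>h. x \<otimes> h \<otimes> inv x", OF _ _ that(2)])
      show "continuous_map T T (\<lambda>h. x \<otimes> h \<otimes> inv x)"
        by (intro continuous_map_topological_group_mult[OF top])
           (use that ts in auto)
      show "\<And>h. h \<in> H \<Longrightarrow> x \<otimes> h \<otimes> inv x \<in> H" using that(1) by (rule inv_op_closed2)
    qed
  qed
qed

text \<open>Conjugation \<open>f\<close> by \<open>g\<close> is an endomorphism: it takes the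
  commutator of \<open>x\<close> and \<open>h\<close> to that of \<open>f x\<close> and
  \<open>f h\<close>, and \<open>h [^] n\<close> to \<open>f h [^] n\<close>. As \<open>f\<close>
  preserves the normal subgroup \<open>H\<close>, the generating set is stable under conjugation, so
  the subgroup it generates is normal, and so is its closure.\<close>

lemma normal_nseries_step:
  fixes G (structure)
  assumes top: "topological_group G T" and H: "H \<lhd> G"
  shows "nseries_step G T n H \<lhd> G"
proof -
  interpret normal H G by (rule H)
  show ?thesis
    unfolding nseries_step_def
  proof (rule normal_closure_of[OF top], rule normal_generateI)
    let ?S = "{inv g \<otimes> inv h \<otimes> g \<otimes> h |g h. g \<in> carrier G \<and> h \<in> H} \<union> {h [^] n |h. h \<in> H}"
    show "?S \<subseteq> carrier G" using mem_carrier by auto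
    fix a g assume a: "a \<in> ?S" and g: "g \<in> carrier G"
    define f where "f = (\<lambda>h. g \<otimes> h \<otimes> inv g)"
    interpret c: group_hom G G f
      using g by unfold_locales (auto simp: f_def hom_def m_assoc inv_r_assoc)
    from a consider x h where "x \<in> carrier G" "h \<in> H" "a = inv x \<otimes> inv h \<otimes> x \<otimes> h"
      | h where "h \<in> H" "a = h [^] n" by blast
    then have "f a \<in> ?S"
    proof cases
      case 1
      then have "f a = inv (f x) \<otimes> inv (f h) \<otimes> f x \<otimes> f h" using mem_carrier by simp
      moreover have "f h \<in> H" "f x \<in> carrier G"
        using 1 g inv_op_closed2 by (auto simp: f_def)
      ultimately show ?thesis by blast
    next
      case 2
      then have "f a = f h [^] n" using c.hom_nat_pow mem_carrier by blast
      moreover have "f h \<in> H" using 2 g inv_op_closed2 by (auto simp: f_def)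
      ultimately show ?thesis by blast
    qed
    then show "g \<otimes> a \<otimes> inv g \<in> ?S" by (simp only: f_def)
  qed
qed

lemma nseries_step_gens:
  fixes G (structure)
  assumes top: "topological_group G T" and H: "H \<subseteq> carrier G"
  shows "\<And>g h. g \<in> carrier G \<Longrightarrow> h \<in> H \<Longrightarrow>
      inv\<^bsub>G\<^esub> g \<otimes>\<^bsub>G\<^esub> inv\<^bsub>G\<^esub> h \<otimes>\<^bsub>G\<^esub> g \<otimes>\<^bsub>G\<^esub> h \<in> nseries_step G T n H"
    and "\<And>h. h \<in> H \<Longrightarrow> h [^]\<^bsub>G\<^esub> n \<in> nseries_step G T n H"
proof -
  interpret group G using top by (simp add: topological_group_def)
  let ?S = "{inv g \<otimes> inv h \<otimes> g \<otimes> h |g h. g \<in> carrier G \<and> h \<in> H} \<union> {h [^] n |h. h \<in> H}"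
  have "?S \<subseteq> carrier G" using H by auto
  then have "generate G ?S \<subseteq> topspace T"
    using top generate_incl by (simp add: topological_group_def)
  then have "?S \<subseteq> nseries_step G T n H"
    unfolding nseries_step_def by (meson closure_of_subset generate.incl subset_iff)
  then show "\<And>g h. g \<in> carrier G \<Longrightarrow> h \<in> H \<Longrightarrow> inv g \<otimes> inv h \<otimes> g \<otimes> h \<in> nseries_step G T n H"
    and "\<And>h. h \<in> H \<Longrightarrow> h [^] n \<in> nseries_step G T n H" by blast+
qed

text \<open>The universal property of the step. It yields both the inclusion of G^(3) in G^(2) and
  the vanishing of an invariant homomorphism on G^(3).\<close>

lemma nseries_step_minimal:
  assumes L: "subgroup L G" "closedin T L" and G: "group G"
    and "\<And>g h. g \<in> carrier G \<Longrightarrow> h \<in> H \<Longrightarrow> inv\<^bsub>G\<^esub> g \<otimes>\<^bsub>G\<^esub> inv\<^bsub>G\<^esub> h \<otimes>\<^bsub>G\<^esub> g \<otimes>\<^bsub>G\<^esub> h \<in> L"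
    and "\<And>h. h \<in> H \<Longrightarrow> h [^]\<^bsub>G\<^esub> n \<in> L"
  shows "nseries_step G T n H \<subseteq> L"
  unfolding nseries_step_def
  by (intro closure_of_minimal group.generate_subgroup_incl[OF G] L) (use assms in auto)

text \<open>The kernel of \<open>u\<close> is a closed subgroup, being the preimage of a point of a
  discrete space. It contains the commutators because invariance gives u(g^-1 h^-1 g) = u(h^-1), and
  the \<open>n\<close>-th powers because \<open>n\<close> kills the coefficients; minimality does
  the rest.\<close>

lemma inv_hom_vanishes_nseries_step:
  fixes G (structure)
  assumes top: "topological_group G T" and K: "K \<lhd> G" "closedin T K"
    and u: "u \<in> inv_hom G T n K"
  shows "nseries_step G T n K \<subseteq> {k \<in> K. u k = 0}"
proof -
  interpret normal K G by (rule K)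
  have hom: "u \<in> hom (G\<lparr>carrier := K\<rparr>) (integer_mod_group n)"
    and cont: "continuous_map (subtopology T K) (zmod_top n) u"
    and inv: "\<And>g h. g \<in> carrier G \<Longrightarrow> h \<in> K \<Longrightarrow> u (inv g \<otimes> h \<otimes> g) = u h"
    using u by (auto simp: inv_hom_def cont_hom_def)
  interpret u: group_hom "G\<lparr>carrier := K\<rparr>" "integer_mod_group n" u
    using hom subgroup_is_group[OF is_group]
    by (simp add: group_hom_def group_hom_axioms_def)
  have mult: "u (x \<otimes> y) = (u x + u y) mod int n" if "x \<in> K" "y \<in> K" for x y
    using u.hom_mult[of x y] that by simp
  have ker: "kernel (G\<lparr>carrier := K\<rparr>) (integer_mod_group n) u = {k \<in> K. u k = 0}"
    by (simp add: kernel_def)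
  have sub: "subgroup {k \<in> K. u k = 0} G"
    using u.subgroup_kernel subgroup_axioms incl_subgroup unfolding ker by blast
  have "closedin (zmod_top n) {0}"
    by (simp add: zmod_top_def)
  then have "closedin (subtopology T K) {k \<in> topspace (subtopology T K). u k \<in> {0}}"
    using cont closedin_continuous_map_preimage by blast
  moreover have "topspace (subtopology T K) = K"
    by (rule topspace_subtopology_subset[OF closedin_subset[OF K(2)]])
  ultimately have "closedin (subtopology T K) {k \<in> K. u k = 0}" by (simp only: singleton_iff)
  then have clo: "closedin T {k \<in> K. u k = 0}"
    by (rule closedin_trans_full[OF _ K(2)])
  show ?thesis
  proof (rule nseries_step_minimal[OF sub clo is_group])
    show "inv g \<otimes> inv h \<otimes> g \<otimes> h \<in> {k \<in> K. u k = 0}" if g: "g \<in> carrier G" and h: "h \<in> K" for g h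
    proof -
      have 1: "inv g \<otimes> inv h \<otimes> g \<in> K" using g h by (simp add: inv_op_closed1)
      have "u (inv g \<otimes> inv h \<otimes> g) = u (inv h)" by (rule inv[OF g m_inv_closed[OF h]])
      then have "u (inv g \<otimes> inv h \<otimes> g \<otimes> h) = u (inv h \<otimes> h)"
        by (simp only: mult[OF 1 h] mult[OF m_inv_closed[OF h] h])
      also have "\<dots> = 0" using u.hom_one h by simp
      finally show ?thesis using subgroup.m_closed[OF subgroup_axioms 1 h] by blast
    qed
    show "h [^] n \<in> {k \<in> K. u k = 0}" if h: "h \<in> K" for h
    proof -
      have "h [^] n \<in> K" using h by (rule nat_pow_mem)
      moreover have "u (h [^]\<^bsub>G\<lparr>carrier := K\<rparr>\<^esub> n) = 0"
        using u.hom_nat_pow[of h n] h by simp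
      then have "u (h [^] n) = 0" by (simp only: nat_pow_consistent[symmetric])
      ultimately show ?thesis by blast
    qed
  qed
qed

section \<open>The members of the series as closed normal subgroups\<close>

lemma
  assumes top: "topological_group G T"
  shows normal_nseries: "nseries G T n (Suc i) \<lhd> G"
    and closedin_nseries: "closedin T (nseries G T n (Suc i))"
proof -
  interpret group G using top by (simp add: topological_group_def)
  have "closedin T (carrier G)"
    using top closedin_topspace unfolding topological_group_def by metis
  then show "closedin T (nseries G T n (Suc i))"
    by (cases i) (auto simp: nseries_def nseries_step_def)
  show nor: "nseries G T n (Suc i) \<lhd> G" for i
  proof (induction i)
    case 0 then show ?case by (simp add: nseries_def normal_self)
  next
    case (Suc i) then show ?case using normal_nseries_step[OF top] by (simp add: nseries_def)
  qed
qed

text \<open>The value \<open>i = 0\<close> is excluded because truncated subtraction makes the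
  members of index 0 and 1 both equal to \<open>carrier G\<close>.\<close>

lemma nseries_Suc: "i \<ge> 1 \<Longrightarrow> nseries G T n (Suc i) = nseries_step G T n (nseries G T n i)"
  by (cases i) (auto simp: nseries_def)

text \<open>The commutator is the unique \<open>x\<close> that corrects \<open>b \<otimes> a\<close>
  to \<open>a \<otimes> b\<close>; in this form it can be identified without handling inverses of
  products.\<close>

lemma (in group) commutator_eqI:
  assumes "a \<in> carrier G" "b \<in> carrier G" "x \<in> carrier G" "a \<otimes> b = b \<otimes> a \<otimes> x"
  shows "inv a \<otimes> inv b \<otimes> a \<otimes> b = x"
proof -
  have "inv a \<otimes> inv b = inv (b \<otimes> a)" using assms by (simp add: inv_mult_group)
  then have "inv a \<otimes> inv b \<otimes> a \<otimes> b = inv (b \<otimes> a) \<otimes> (a \<otimes> b)"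
    using assms(1,2) by (simp add: m_assoc)
  also have "\<dots> = x" unfolding assms(4) using assms(1-3) by (intro inv_r_assoc) auto
  finally show ?thesis .
qed

text \<open>Central factors can be collected at the front of both products and then cancel. This is
  why the bracket does not depend on the lifts: two lifts differ by an element of G^(2)/G^(3), which
  is central in G/G^(3).\<close>

lemma (in group) commutator_central_mult:
  assumes carr: "a \<in> carrier G" "b \<in> carrier G" "c \<in> carrier G" "d \<in> carrier G"
    and c: "\<And>x. x \<in> carrier G \<Longrightarrow> c \<otimes> x = x \<otimes> c"
    and d: "\<And>x. x \<in> carrier G \<Longrightarrow> d \<otimes> x = x \<otimes> d"
  shows "inv (c \<otimes> a) \<otimes> inv (d \<otimes> b) \<otimes> (c \<otimes> a) \<otimes> (d \<otimes> b) = inv a \<otimes> inv b \<otimes> a \<otimes> b"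
proof (rule commutator_eqI)
  let ?x = "inv a \<otimes> inv b \<otimes> a \<otimes> b"
  have ba: "(b \<otimes> a) \<otimes> ?x = a \<otimes> b" using carr by (simp add: m_assoc r_inv_assoc)
  have "(d \<otimes> b) \<otimes> (c \<otimes> a) = d \<otimes> c \<otimes> (b \<otimes> a)"
    using carr c[of b] by (metis m_assoc m_closed)
  then have "(d \<otimes> b) \<otimes> (c \<otimes> a) \<otimes> ?x = d \<otimes> c \<otimes> ((b \<otimes> a) \<otimes> ?x)"
    by (metis carr inv_closed m_assoc m_closed)
  also have "\<dots> = (c \<otimes> a) \<otimes> (d \<otimes> b)"
    unfolding ba using carr c[of d] d[of a] by (metis m_assoc m_closed)
  finally show "(c \<otimes> a) \<otimes> (d \<otimes> b) = (d \<otimes> b) \<otimes> (c \<otimes> a) \<otimes> ?x" by simp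
qed (use carr in auto)

text \<open>The generators of G^(3) make G^(2)/G^(3) central in G/G^(3) and kill its
  \<open>n\<close>-th powers. Hence changing a lift by an element of G^(2) alters neither the
  commutator nor the \<open>n\<close>-th power, and the operations on cosets can be computed on
  representatives in \<open>G\<close>.\<close>

lemma
  fixes G :: "'a monoid" and T :: "'a topology" and n :: nat
  assumes top: "topological_group G T" and g: "g \<in> carrier G"
  defines "K \<equiv> nseries G T n 2" and "N \<equiv> nseries G T n 3"
  shows gr_bracket_coset: "\<And>h. h \<in> carrier G \<Longrightarrow> gr_bracket G T n (K #>\<^bsub>G\<^esub> g) (K #>\<^bsub>G\<^esub> h)
        = N #>\<^bsub>G\<^esub> (inv\<^bsub>G\<^esub> g \<otimes>\<^bsub>G\<^esub> inv\<^bsub>G\<^esub> h \<otimes>\<^bsub>G\<^esub> g \<otimes>\<^bsub>G\<^esub> h)"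
    and gr_pi_coset: "gr_pi G T n (K #>\<^bsub>G\<^esub> g) = N #>\<^bsub>G\<^esub> (g [^]\<^bsub>G\<^esub> n)"
proof -
  have N_eq: "N = nseries_step G T n K"
    using nseries_Suc[of 2 G T n] by (simp add: N_def K_def numeral_3_eq_3)
  have K_nor: "K \<lhd> G" unfolding K_def numeral_2_eq_2 by (rule normal_nseries[OF top])
  have K_clo: "closedin T K" unfolding K_def numeral_2_eq_2 by (rule closedin_nseries[OF top])
  have N_nor: "N \<lhd> G" unfolding N_def numeral_3_eq_3 by (rule normal_nseries[OF top])
  interpret K: normal K G by (rule K_nor)
  interpret N: normal N G by (rule N_nor)
  define Q where "Q = G Mod N"
  interpret Q: group Q unfolding Q_def by (rule N.factorgroup_is_group)
  interpret p: group_hom G Q "\<lambda>a. N #>\<^bsub>G\<^esub> a"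
    using N.r_coset_hom_Mod K.is_group Q.is_group
    by (simp add: group_hom_def group_hom_axioms_def Q_def)
  \<comment> \<open>\<open>K\<close> is closed and normal, so it contains the commutators and powers
    formed from its own elements.\<close>
  have NK: "N \<subseteq> K"
    unfolding N_eq
    by (rule nseries_step_minimal[OF K.subgroup_axioms K_clo K.is_group])
       (simp_all add: K.inv_op_closed1 K.nat_pow_mem)
  \<comment> \<open>The commutator of \<open>a\<close> and \<open>k\<close> is one of the generators
    of \<open>N\<close>, so the images of \<open>a\<close> and \<open>k\<close> commute in
    \<open>Q\<close>.\<close>
  have central: "(N #>\<^bsub>G\<^esub> k) \<otimes>\<^bsub>Q\<^esub> X = X \<otimes>\<^bsub>Q\<^esub> (N #>\<^bsub>G\<^esub> k)"
    if k: "k \<in> K" and X: "X \<in> carrier Q" for k X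
  proof -
    obtain a where a: "a \<in> carrier G" and X: "X = N #>\<^bsub>G\<^esub> a"
      using X by (auto simp: Q_def carrier_FactGroup)
    have kG: "k \<in> carrier G" using k by (rule K.mem_carrier)
    have "inv\<^bsub>G\<^esub> a \<otimes>\<^bsub>G\<^esub> inv\<^bsub>G\<^esub> k \<otimes>\<^bsub>G\<^esub> a \<otimes>\<^bsub>G\<^esub> k \<in> N"
      unfolding N_eq using nseries_step_gens(1)[OF top K.subset a k] .
    then have "N #>\<^bsub>G\<^esub> (inv\<^bsub>G\<^esub> a \<otimes>\<^bsub>G\<^esub> inv\<^bsub>G\<^esub> k \<otimes>\<^bsub>G\<^esub> a \<otimes>\<^bsub>G\<^esub> k) = \<one>\<^bsub>Q\<^esub>"
      using N.rcos_const by (simp add: Q_def)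
    then have "(N #>\<^bsub>G\<^esub> (k \<otimes>\<^bsub>G\<^esub> a)) \<otimes>\<^bsub>Q\<^esub> (N #>\<^bsub>G\<^esub> (inv\<^bsub>G\<^esub> a \<otimes>\<^bsub>G\<^esub> inv\<^bsub>G\<^esub> k \<otimes>\<^bsub>G\<^esub> a \<otimes>\<^bsub>G\<^esub> k)) = N #>\<^bsub>G\<^esub> (k \<otimes>\<^bsub>G\<^esub> a)"
      using a kG by simp
    moreover have "(k \<otimes>\<^bsub>G\<^esub> a) \<otimes>\<^bsub>G\<^esub> (inv\<^bsub>G\<^esub> a \<otimes>\<^bsub>G\<^esub> inv\<^bsub>G\<^esub> k \<otimes>\<^bsub>G\<^esub> a \<otimes>\<^bsub>G\<^esub> k) = a \<otimes>\<^bsub>G\<^esub> k"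
      using a kG by (simp add: K.m_assoc K.r_inv_assoc)
    moreover have "N #>\<^bsub>G\<^esub> ((k \<otimes>\<^bsub>G\<^esub> a) \<otimes>\<^bsub>G\<^esub> (inv\<^bsub>G\<^esub> a \<otimes>\<^bsub>G\<^esub> inv\<^bsub>G\<^esub> k \<otimes>\<^bsub>G\<^esub> a \<otimes>\<^bsub>G\<^esub> k))
        = (N #>\<^bsub>G\<^esub> (k \<otimes>\<^bsub>G\<^esub> a)) \<otimes>\<^bsub>Q\<^esub> (N #>\<^bsub>G\<^esub> (inv\<^bsub>G\<^esub> a \<otimes>\<^bsub>G\<^esub> inv\<^bsub>G\<^esub> k \<otimes>\<^bsub>G\<^esub> a \<otimes>\<^bsub>G\<^esub> k))"
      by (rule p.hom_mult) (use a kG in auto)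
    ultimately have "N #>\<^bsub>G\<^esub> (a \<otimes>\<^bsub>G\<^esub> k) = N #>\<^bsub>G\<^esub> (k \<otimes>\<^bsub>G\<^esub> a)" by (simp only:)
    then show ?thesis unfolding X by (simp only: p.hom_mult a kG)
  qed
  have lift: "\<exists>k\<in>K. s = (N #>\<^bsub>G\<^esub> k) \<otimes>\<^bsub>Q\<^esub> (N #>\<^bsub>G\<^esub> a)"
    if "s \<in> gr1_lifts G T n (K #>\<^bsub>G\<^esub> a)" "a \<in> carrier G" for s a
  proof -
    have s: "s \<in> carrier (G Mod N)" "s \<subseteq> K #>\<^bsub>G\<^esub> a"
      using that(1) by (simp_all only: gr1_lifts_def N_def mem_Collect_eq)
    obtain b where b: "b \<in> carrier G" "s = N #>\<^bsub>G\<^esub> b"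
      using s(1) unfolding carrier_FactGroup by (rule imageE)
    have "b \<in> s" unfolding b(2) by (rule K.rcos_self[OF b(1) N.subgroup_axioms])
    then obtain k where "k \<in> K" "b = k \<otimes>\<^bsub>G\<^esub> a" using s(2) by (auto simp: r_coset_def)
    then have "s = (N #>\<^bsub>G\<^esub> k) \<otimes>\<^bsub>Q\<^esub> (N #>\<^bsub>G\<^esub> a)"
      using b(2) p.hom_mult[OF K.mem_carrier that(2)] by simp
    then show ?thesis using \<open>k \<in> K\<close> by blast
  qed
  \<comment> \<open>\<open>the_elem\<close> is meaningful only if the set of values is nonempty as
    well as constant; the coset of \<open>a\<close> itself is a lift.\<close>
  have lift_ex: "N #>\<^bsub>G\<^esub> a \<in> gr1_lifts G T n (K #>\<^bsub>G\<^esub> a)" if "a \<in> carrier G" for a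
  proof -
    have "N #>\<^bsub>G\<^esub> a \<subseteq> K #>\<^bsub>G\<^esub> a" using NK by (auto simp: r_coset_def)
    moreover have "N #>\<^bsub>G\<^esub> a \<in> carrier (G Mod N)"
      unfolding carrier_FactGroup using that by (rule imageI)
    ultimately show ?thesis by (simp only: gr1_lifts_def N_def mem_Collect_eq)
  qed
  show "gr_bracket G T n (K #>\<^bsub>G\<^esub> g) (K #>\<^bsub>G\<^esub> h)
        = N #>\<^bsub>G\<^esub> (inv\<^bsub>G\<^esub> g \<otimes>\<^bsub>G\<^esub> inv\<^bsub>G\<^esub> h \<otimes>\<^bsub>G\<^esub> g \<otimes>\<^bsub>G\<^esub> h)" if h: "h \<in> carrier G" for h
  proof -
    let ?c = "\<lambda>s t. inv\<^bsub>Q\<^esub> s \<otimes>\<^bsub>Q\<^esub> inv\<^bsub>Q\<^esub> t \<otimes>\<^bsub>Q\<^esub> s \<otimes>\<^bsub>Q\<^esub> t"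
    let ?L = "gr1_lifts G T n (K #>\<^bsub>G\<^esub> g)" and ?M = "gr1_lifts G T n (K #>\<^bsub>G\<^esub> h)"
    have val: "?c s t = N #>\<^bsub>G\<^esub> (inv\<^bsub>G\<^esub> g \<otimes>\<^bsub>G\<^esub> inv\<^bsub>G\<^esub> h \<otimes>\<^bsub>G\<^esub> g \<otimes>\<^bsub>G\<^esub> h)"
      if s: "s \<in> ?L" and t: "t \<in> ?M" for s t
    proof -
      obtain k where k: "k \<in> K" "s = (N #>\<^bsub>G\<^esub> k) \<otimes>\<^bsub>Q\<^esub> (N #>\<^bsub>G\<^esub> g)" using lift[OF s g] by blast
      obtain l where l: "l \<in> K" "t = (N #>\<^bsub>G\<^esub> l) \<otimes>\<^bsub>Q\<^esub> (N #>\<^bsub>G\<^esub> h)" using lift[OF t h] by blast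
      have "?c s t = ?c (N #>\<^bsub>G\<^esub> g) (N #>\<^bsub>G\<^esub> h)"
        unfolding k(2) l(2)
        by (rule Q.commutator_central_mult[OF _ _ _ _ central[OF k(1)] central[OF l(1)]])
           (simp_all add: g h k(1) l(1) K.mem_carrier)
      then show ?thesis using g h by simp
    qed
    have "{?c s t | s t. s \<in> ?L \<and> t \<in> ?M} = {N #>\<^bsub>G\<^esub> (inv\<^bsub>G\<^esub> g \<otimes>\<^bsub>G\<^esub> inv\<^bsub>G\<^esub> h \<otimes>\<^bsub>G\<^esub> g \<otimes>\<^bsub>G\<^esub> h)}"
      using val lift_ex[OF g] lift_ex[OF h] by blast
    then show ?thesis by (simp add: gr_bracket_def N_def[symmetric] Q_def[symmetric] Let_def)
  qed
  show "gr_pi G T n (K #>\<^bsub>G\<^esub> g) = N #>\<^bsub>G\<^esub> (g [^]\<^bsub>G\<^esub> n)"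
  proof -
    let ?L = "gr1_lifts G T n (K #>\<^bsub>G\<^esub> g)"
    have val: "s [^]\<^bsub>Q\<^esub> n = N #>\<^bsub>G\<^esub> (g [^]\<^bsub>G\<^esub> n)" if s: "s \<in> ?L" for s
    proof -
      obtain k where k: "k \<in> K" "s = (N #>\<^bsub>G\<^esub> k) \<otimes>\<^bsub>Q\<^esub> (N #>\<^bsub>G\<^esub> g)" using lift[OF s g] by blast
      have kG: "k \<in> carrier G" using k(1) by (rule K.mem_carrier)
      have "k [^]\<^bsub>G\<^esub> n \<in> N" unfolding N_eq using nseries_step_gens(2)[OF top K.subset k(1)] .
      then have 1: "(N #>\<^bsub>G\<^esub> k) [^]\<^bsub>Q\<^esub> n = \<one>\<^bsub>Q\<^esub>"
        using p.hom_nat_pow[OF kG, of n] N.rcos_const by (simp add: Q_def)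
      \<comment> \<open>The power of the product splits because the first factor is central, and
        that factor then disappears since \<open>k [^] n\<close> lies in \<open>N\<close>.\<close>
      have "s [^]\<^bsub>Q\<^esub> n = (N #>\<^bsub>G\<^esub> k) [^]\<^bsub>Q\<^esub> n \<otimes>\<^bsub>Q\<^esub> (N #>\<^bsub>G\<^esub> g) [^]\<^bsub>Q\<^esub> n"
        unfolding k(2) by (rule Q.pow_mult_distrib[OF central[OF k(1)]]) (simp_all add: kG g)
      then show ?thesis using 1 g by (simp add: p.hom_nat_pow)
    qed
    have "{s [^]\<^bsub>Q\<^esub> n | s. s \<in> ?L} = {N #>\<^bsub>G\<^esub> (g [^]\<^bsub>G\<^esub> n)}"
      using val lift_ex[OF g] by blast
    then show ?thesis by (simp add: gr_pi_def N_def[symmetric] Q_def[symmetric] Let_def)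
  qed
qed

section \<open>Quotient topological groups\<close>

text \<open>The preimage of the image of \<open>U\<close> is the union of the translates of
  \<open>U\<close> by elements of \<open>K\<close>, and each translate is open.\<close>

lemma open_map_quot_topology:
  fixes G (structure)
  assumes top: "topological_group G T" and K: "K \<lhd> G"
  shows "open_map T (quot_topology G T K) (\<lambda>g. K #> g)"
  unfolding open_map_def
proof (intro allI impI)
  fix U assume U: "openin T U"
  interpret normal K G by (rule K)
  have ts: "topspace T = carrier G" using top by (simp add: topological_group_def)
  have UG: "U \<subseteq> carrier G" using openin_subset[OF U] ts by blast
  have "openin T {g \<in> topspace T. K #> g \<in> (\<lambda>g. K #> g) ` U}"
  proof (subst openin_subopen, intro ballI)
    fix x assume "x \<in> {g \<in> topspace T. K #> g \<in> (\<lambda>g. K #> g) ` U}"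
    then obtain g where x: "x \<in> carrier G" and g: "g \<in> U" "K #> x = K #> g"
      using ts by auto
    have "x \<in> K #> g" unfolding g(2)[symmetric] by (rule rcos_self[OF x subgroup_axioms])
    then obtain k where k: "k \<in> K" "x = k \<otimes> g" by (auto simp: r_coset_def)
    have kG: "k \<in> carrier G" using k(1) by (rule mem_carrier)
    \<comment> \<open>This is the translate of \<open>U\<close> by \<open>k\<close>, written as a
      preimage under left multiplication by \<open>inv k\<close> so that continuity shows it to be
      open.\<close>
    let ?V = "{y \<in> topspace T. inv k \<otimes> y \<in> U}"
    have "continuous_map T T (\<lambda>y. inv k \<otimes> y)"
      by (intro continuous_map_topological_group_mult[OF top]) (use kG ts in auto)
    then have "openin T ?V" using U by (rule openin_continuous_map_preimage)
    moreover have "x \<in> ?V"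
      using x g(1) k(2) kG UG ts by (auto simp: inv_r_assoc subset_iff)
    moreover have "?V \<subseteq> {g \<in> topspace T. K #> g \<in> (\<lambda>g. K #> g) ` U}"
    proof
      fix y assume y: "y \<in> ?V"
      then have yG: "y \<in> carrier G" using ts by simp
      have "inv k \<otimes> y \<in> K #> y" using k(1) by (auto simp: r_coset_def)
      then have "K #> y = K #> (inv k \<otimes> y)"
        using repr_independence[OF _ yG subgroup_axioms] by blast
      then show "y \<in> {g \<in> topspace T. K #> g \<in> (\<lambda>g. K #> g) ` U}" using y by blast
    qed
    ultimately show "\<exists>V. openin T V \<and> x \<in> V \<and> V \<subseteq> {g \<in> topspace T. K #> g \<in> (\<lambda>g. K #> g) ` U}"
      by blast
  qed
  moreover have "(\<lambda>g. K #> g) ` U \<subseteq> (\<lambda>g. K #> g) ` topspace T"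
    using UG ts by blast
  ultimately show "openin (quot_topology G T K) ((\<lambda>g. K #> g) ` U)"
    by (simp only: openin_quot_topology simp_thms)
qed

text \<open>A product of quotient maps need not be a quotient map, so continuity of multiplication
  cannot simply be descended. Instead a box inside the preimage of \<open>W\<close> is pushed
  forward along the open projection. Inversion has one argument and does descend directly.\<close>

lemma topological_group_quot:
  fixes G (structure)
  assumes top: "topological_group G T" and K: "K \<lhd> G"
  shows "topological_group (G Mod K) (quot_topology G T K)"
proof -
  interpret normal K G by (rule K)
  let ?Q = "quot_topology G T K" and ?q = "\<lambda>g. K #> g"
  have ts: "topspace T = carrier G" and
    cm: "continuous_map (prod_topology T T) T (\<lambda>(g, h). g \<otimes> h)" and
    ci: "continuous_map T T (\<lambda>g. inv g)"
    using top by (auto simp: topological_group_def)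
  have tsQ: "topspace ?Q = carrier (G Mod K)"
    by (simp add: topspace_quot_topology ts carrier_FactGroup)
  have q: "quotient_map T ?Q ?q" by (rule quotient_map_quot_topology)
  then have qc: "continuous_map T ?Q ?q" by (rule quotient_imp_continuous_map)
  have qo: "open_map T ?Q ?q" by (rule open_map_quot_topology[OF top K])
  have "continuous_map (prod_topology ?Q ?Q) ?Q (\<lambda>(A, B). A \<otimes>\<^bsub>G Mod K\<^esub> B)"
    unfolding continuous_map_def
  proof (intro conjI allI impI)
    show "(\<lambda>(A, B). A \<otimes>\<^bsub>G Mod K\<^esub> B) \<in> topspace (prod_topology ?Q ?Q) \<rightarrow> topspace ?Q"
      using group.is_monoid[OF factorgroup_is_group] monoid.m_closed
      by (fastforce simp: tsQ)
    fix W assume W: "openin ?Q W"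
    have oW: "openin (prod_topology T T) {p \<in> topspace (prod_topology T T). ?q (fst p \<otimes> snd p) \<in> W}"
      using openin_continuous_map_preimage[OF continuous_map_compose[OF cm qc] W]
      by (simp add: o_def case_prod_unfold)
    show "openin (prod_topology ?Q ?Q)
        {p \<in> topspace (prod_topology ?Q ?Q). (case p of (A, B) \<Rightarrow> A \<otimes>\<^bsub>G Mod K\<^esub> B) \<in> W}" (is "openin _ ?P")
    proof (subst openin_prod_topology_alt, intro allI impI)
      fix A B assume AB: "(A, B) \<in> ?P"
      then obtain g h where g: "g \<in> carrier G" "A = ?q g" and h: "h \<in> carrier G" "B = ?q h"
        by (auto simp: tsQ carrier_FactGroup)
      have "(g, h) \<in> {p \<in> topspace (prod_topology T T). ?q (fst p \<otimes> snd p) \<in> W}"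
        using AB g h by (simp add: ts rcos_sum)
      then obtain U V where UV: "openin T U" "openin T V" "g \<in> U" "h \<in> V"
          "U \<times> V \<subseteq> {p \<in> topspace (prod_topology T T). ?q (fst p \<otimes> snd p) \<in> W}"
        using oW unfolding openin_prod_topology_alt by meson
      have "?q ` U \<times> ?q ` V \<subseteq> ?P"
      proof
        fix p assume "p \<in> ?q ` U \<times> ?q ` V"
        then obtain a b where ab: "a \<in> U" "b \<in> V" "p = (?q a, ?q b)" by blast
        then have "(a, b) \<in> {p \<in> topspace (prod_topology T T). ?q (fst p \<otimes> snd p) \<in> W}"
          using UV(5) by blast
        then have "a \<in> carrier G" "b \<in> carrier G" "?q (a \<otimes> b) \<in> W" by (auto simp: ts)
        moreover from this have "?q a \<in> topspace ?Q" "?q b \<in> topspace ?Q"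
          unfolding tsQ carrier_FactGroup by blast+
        ultimately show "p \<in> ?P" unfolding ab(3) by (simp add: rcos_sum)
      qed
      moreover have "openin ?Q (?q ` U)" "openin ?Q (?q ` V)"
        using qo UV(1,2) by (simp_all add: open_map_def)
      moreover have "A \<in> ?q ` U" "B \<in> ?q ` V" using UV(3,4) g(2) h(2) by simp_all
      ultimately show "\<exists>U V. openin ?Q U \<and> openin ?Q V \<and> A \<in> U \<and> B \<in> V \<and> U \<times> V \<subseteq> ?P"
        by (intro exI conjI)
    qed
  qed
  moreover have "continuous_map ?Q ?Q (\<lambda>A. inv\<^bsub>G Mod K\<^esub> A)"
  proof (rule continuous_compose_quotient_map[OF q])
    have "continuous_map T ?Q (?q \<circ> (\<lambda>g. inv g))" using ci qc by (rule continuous_map_compose)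
    then show "continuous_map T ?Q ((\<lambda>A. inv\<^bsub>G Mod K\<^esub> A) \<circ> ?q)"
      by (rule continuous_map_eq) (simp add: ts inv_FactGroup carrier_FactGroup rcos_inv)
  qed
  ultimately show ?thesis
    unfolding topological_group_def using factorgroup_is_group tsQ by blast
qed

section \<open>Locally constant functions as continuous functions to a discrete space\<close>

definition locally_constant :: "'a topology \<Rightarrow> ('a \<Rightarrow> 'b) \<Rightarrow> bool" where
  "locally_constant X f \<longleftrightarrow> (\<forall>x\<in>topspace X. \<exists>U. openin X U \<and> x \<in> U \<and> (\<forall>y\<in>U. f y = f x))"

text \<open>Separates the range condition from the topological one, so that locally constant
  functions can be composed with arbitrary functions on values without tracking codomains.\<close>

lemma continuous_map_discrete_iff:
  "continuous_map X (discrete_topology A) f \<longleftrightarrow> f \<in> topspace X \<rightarrow> A \<and> locally_constant X f"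
proof (intro iffI conjI)
  assume f: "continuous_map X (discrete_topology A) f"
  then show fA: "f \<in> topspace X \<rightarrow> A" by (simp add: continuous_map_def)
  show "locally_constant X f"
    unfolding locally_constant_def
  proof
    fix x assume x: "x \<in> topspace X"
    have "openin X {y \<in> topspace X. f y \<in> {f x}}"
      by (rule openin_continuous_map_preimage[OF f]) (use fA x in auto)
    then show "\<exists>U. openin X U \<and> x \<in> U \<and> (\<forall>y\<in>U. f y = f x)" using x by blast
  qed
next
  assume "f \<in> topspace X \<rightarrow> A \<and> locally_constant X f"
  then have fA: "f \<in> topspace X \<rightarrow> A" and lc: "locally_constant X f" by auto
  show "continuous_map X (discrete_topology A) f"
    unfolding continuous_map_def
  proof (intro conjI allI impI)
    show "f \<in> topspace X \<rightarrow> topspace (discrete_topology A)" using fA by simp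
    fix U
    show "openin X {x \<in> topspace X. f x \<in> U}"
    proof (subst openin_subopen, intro ballI)
      fix x assume x: "x \<in> {x \<in> topspace X. f x \<in> U}"
      then obtain V where V: "openin X V" "x \<in> V" "\<forall>y\<in>V. f y = f x"
        using lc unfolding locally_constant_def by blast
      have "V \<subseteq> {x \<in> topspace X. f x \<in> U}"
        using x V(3) openin_subset[OF V(1)] by auto
      then show "\<exists>V. openin X V \<and> x \<in> V \<and> V \<subseteq> {x \<in> topspace X. f x \<in> U}"
        using V by blast
    qed
  qed
qed

lemma locally_constant_comp2:
  assumes "locally_constant X f" "locally_constant X g"
  shows "locally_constant X (\<lambda>x. h (f x) (g x))"
  unfolding locally_constant_def
proof
  fix x assume x: "x \<in> topspace X"
  obtain U where U: "openin X U" "x \<in> U" "\<forall>y\<in>U. f y = f x"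
    using assms(1) x unfolding locally_constant_def by blast
  obtain V where V: "openin X V" "x \<in> V" "\<forall>y\<in>V. g y = g x"
    using assms(2) x unfolding locally_constant_def by blast
  have "h (f y) (g y) = h (f x) (g x)" if "y \<in> U \<inter> V" for y
  proof -
    have "f y = f x" "g y = g x" using U(3) V(3) that by blast+
    then show ?thesis by (simp only:)
  qed
  moreover have "openin X (U \<inter> V)" "x \<in> U \<inter> V" using U V by (blast intro: openin_Int)+
  ultimately show "\<exists>U. openin X U \<and> x \<in> U \<and> (\<forall>y\<in>U. h (f y) (g y) = h (f x) (g x))" by blast
qed

lemma locally_constant_comp:
  "locally_constant X f \<Longrightarrow> locally_constant X (\<lambda>x. h (f x))"
  using locally_constant_comp2[of X f f "\<lambda>a _. h a"] .

lemma locally_constant_compose: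
  assumes "continuous_map X Y p" "locally_constant Y f"
  shows "locally_constant X (\<lambda>x. f (p x))"
  unfolding locally_constant_def
proof
  fix x assume x: "x \<in> topspace X"
  then have "p x \<in> topspace Y" using assms(1) by (auto simp: continuous_map_def)
  then obtain U where U: "openin Y U" "p x \<in> U" "\<forall>y\<in>U. f y = f (p x)"
    using assms(2) unfolding locally_constant_def by blast
  have "openin X {z \<in> topspace X. p z \<in> U}"
    using assms(1) U(1) by (rule openin_continuous_map_preimage)
  then show "\<exists>V. openin X V \<and> x \<in> V \<and> (\<forall>y\<in>V. f (p y) = f (p x))" using x U by blast
qed

lemma locally_constant_cong:
  assumes "\<And>x. x \<in> topspace X \<Longrightarrow> f x = g x" "locally_constant X f"
  shows "locally_constant X g"
  unfolding locally_constant_def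
proof
  fix x assume x: "x \<in> topspace X"
  then obtain U where U: "openin X U" "x \<in> U" "\<forall>y\<in>U. f y = f x"
    using assms(2) unfolding locally_constant_def by blast
  have "g y = g x" if "y \<in> U" for y
  proof -
    have "y \<in> topspace X" "f y = f x" using U that openin_subset[OF U(1)] by blast+
    then show ?thesis using assms(1) x by metis
  qed
  then show "\<exists>U. openin X U \<and> x \<in> U \<and> (\<forall>y\<in>U. g y = g x)" using U by blast
qed

section \<open>Cochains\<close>

text \<open>For \<open>m = 0\<close> the carrier is all of the integers and reduction modulo
  \<open>m\<close> is the identity, which is why that case is split off.\<close>

lemma mod_in_carrier_integer_mod_group: "a mod int m \<in> carrier (integer_mod_group m)"
  by (cases "m = 0") (auto simp: carrier_integer_mod_group)

lemma mod_carrier_integer_mod_group: "a \<in> carrier (integer_mod_group m) \<Longrightarrow> a mod int m = a"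
  by (cases "m = 0") (auto simp: carrier_integer_mod_group)

lemma cochains_iff:
  assumes "topspace T = carrier G"
  shows "f \<in> cochains G T m k \<longleftrightarrow> f \<in> tuples G k \<rightarrow>\<^sub>E carrier (integer_mod_group m) \<and>
    locally_constant (product_topology (\<lambda>_. T) {..<k}) f"
  using assms by (auto simp: cochains_def zmod_top_def continuous_map_discrete_iff tuples_def)

text \<open>All functions on tuples, continuous or not. Continuous cochains, cocycles and
  coboundaries then appear as subgroups and inherit the group laws.\<close>

abbreviation cochain_prod :: "'a monoid \<Rightarrow> nat \<Rightarrow> nat \<Rightarrow> ((nat \<Rightarrow> 'a) \<Rightarrow> int) monoid" where
  "cochain_prod G m k \<equiv> product_group (tuples G k) (\<lambda>_. integer_mod_group m)"

lemma comm_group_cochain_prod: "comm_group (cochain_prod G m k)"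
  by (rule group.group_comm_groupI) (auto simp: add.commute)

lemma mult_cochain_group:
  "f \<otimes>\<^bsub>cochain_group G T m k\<^esub> g = (\<lambda>x\<in>tuples G k. (f x + g x) mod int m)"
  by (simp add: cochain_group_def)

lemma one_cochain_group: "\<one>\<^bsub>cochain_group G T m k\<^esub> = (\<lambda>x\<in>tuples G k. 0)"
  by (simp add: cochain_group_def)

lemma subgroup_cochains:
  assumes ts: "topspace T = carrier G"
  shows "subgroup (cochains G T m k) (cochain_prod G m k)"
proof -
  let ?X = "product_topology (\<lambda>_. T) {..<k}"
  have tsX: "topspace ?X = tuples G k" by (simp add: tuples_def ts)
  interpret comm_group "cochain_prod G m k" by (rule comm_group_cochain_prod)
  show ?thesis
  proof (rule subgroupI)
    show "cochains G T m k \<subseteq> carrier (cochain_prod G m k)"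
      by (auto simp: cochains_def)
    have "(\<lambda>x\<in>tuples G k. 0) \<in> cochains G T m k"
      unfolding cochains_iff[OF ts]
    proof
      show "locally_constant ?X (\<lambda>x\<in>tuples G k. 0::int)"
        unfolding locally_constant_def tsX by (metis openin_topspace tsX restrict_apply')
    qed auto
    then show "cochains G T m k \<noteq> {}" by blast
    fix f assume f: "f \<in> cochains G T m k"
    then have fP: "f \<in> tuples G k \<rightarrow>\<^sub>E carrier (integer_mod_group m)" and lf: "locally_constant ?X f"
      by (auto simp: cochains_iff[OF ts])
    have "locally_constant ?X (\<lambda>x\<in>tuples G k. (- f x) mod int m)"
      by (rule locally_constant_cong[OF _ locally_constant_comp[OF lf, of "\<lambda>a. (- a) mod int m"]])
         (simp add: tuples_def ts)
    moreover have "inv\<^bsub>cochain_prod G m k\<^esub> f = (\<lambda>x\<in>tuples G k. (- f x) mod int m)"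
      using inv_product_group[OF fP] PiE_mem[OF fP] by (auto intro!: restrict_ext)
    ultimately show "inv\<^bsub>cochain_prod G m k\<^esub> f \<in> cochains G T m k"
      by (auto simp: cochains_iff[OF ts] intro: mod_in_carrier_integer_mod_group)
    fix g assume g: "g \<in> cochains G T m k"
    then have lg: "locally_constant ?X g" by (auto simp: cochains_iff[OF ts])
    have "locally_constant ?X (\<lambda>x\<in>tuples G k. (f x + g x) mod int m)"
      by (rule locally_constant_cong[OF _ locally_constant_comp2[OF lf lg, of "\<lambda>a b. (a + b) mod int m"]])
         (simp add: tuples_def ts)
    then show "f \<otimes>\<^bsub>cochain_prod G m k\<^esub> g \<in> cochains G T m k"
      by (auto simp: cochains_iff[OF ts] intro: mod_in_carrier_integer_mod_group)
  qed
qed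

lemma tuples_mem: "x \<in> tuples G k \<Longrightarrow> i < k \<Longrightarrow> x i \<in> carrier G"
  unfolding tuples_def using PiE_mem[of x "{..<k}" "\<lambda>_. carrier G" i] by simp

lemma merge_at_in_tuples:
  fixes G (structure)
  assumes "group G" "x \<in> tuples G (Suc k)" "i < k"
  shows "merge_at G k i x \<in> tuples G k"
proof -
  interpret group G by fact
  have "x j \<in> carrier G" if "j \<le> k" for j
    using tuples_mem[OF assms(2)] that by simp
  then have "(if j < i then x j else if j = i then x i \<otimes> x (Suc i) else x (Suc j)) \<in> carrier G" if "j < k" for j
    using assms(3) that by simp
  then show ?thesis unfolding merge_at_def tuples_def by (intro restrict_PiE_iff[THEN iffD2] ballI) simp
qed

text \<open>The coboundary is an integer combination of values of \<open>f\<close>, reduced once at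
  the end, so congruences pass through each summand. Taking all functions as source and target gives
  the statement in every degree without showing that coboundaries are continuous.\<close>

lemma cobd_hom:
  assumes G: "group G"
  shows "cobd G m k \<in> hom (cochain_prod G m k) (cochain_prod G m (Suc k))"
proof (rule homI)
  fix f g
  show "cobd G m k f \<in> carrier (cochain_prod G m (Suc k))"
    by (auto simp: cobd_def intro: mod_in_carrier_integer_mod_group)
  let ?h = "f \<otimes>\<^bsub>cochain_prod G m k\<^esub> g"
  have h: "[?h x = f x + g x] (mod int m)" if "x \<in> tuples G k" for x
    using that by (simp add: cong_def)
  have "cobd G m k ?h x = (cobd G m k f x + cobd G m k g x) mod int m" if x: "x \<in> tuples G (Suc k)" for x
  proof -
    let ?D = "\<lambda>f. f (\<lambda>j\<in>{..<k}. x (Suc j)) + (\<Sum>i<k. (-1) ^ Suc i * f (merge_at G k i x))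
      + (-1) ^ Suc k * f (restrict x {..<k})"
    have 1: "(\<lambda>j\<in>{..<k}. x (Suc j)) \<in> tuples G k" and 2: "restrict x {..<k} \<in> tuples G k"
      using tuples_mem[OF x] by (simp_all add: tuples_def restrict_PiE_iff)
    let ?S = "(f (\<lambda>j\<in>{..<k}. x (Suc j)) + g (\<lambda>j\<in>{..<k}. x (Suc j)))
        + (\<Sum>i<k. (-1) ^ Suc i * (f (merge_at G k i x) + g (merge_at G k i x)))
        + (-1) ^ Suc k * (f (restrict x {..<k}) + g (restrict x {..<k}))"
    have "[?D ?h = ?S] (mod int m)"
      by (intro cong_add cong_mult cong_sum cong_refl h 1 2)
         (use merge_at_in_tuples[OF G x] in auto)
    moreover have "?S = ?D f + ?D g"
      by (simp only: distrib_left sum.distrib add_ac)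
    ultimately have "?D ?h mod int m = (?D f mod int m + ?D g mod int m) mod int m"
      by (simp only: cong_def mod_add_eq)
    then show ?thesis using x by (simp only: cobd_def restrict_apply')
  qed
  then show "cobd G m k ?h = cobd G m k f \<otimes>\<^bsub>cochain_prod G m (Suc k)\<^esub> cobd G m k g"
    by (auto simp: cobd_def)
qed

lemma group_hom_cobd:
  assumes G: "group G" and ts: "topspace T = carrier G"
  shows "group_hom ((cochain_prod G m k)\<lparr>carrier := cochains G T m k\<rparr>) (cochain_prod G m (Suc k)) (cobd G m k)"
proof -
  have P: "group (cochain_prod G m i)" for i using comm_group_cochain_prod by (simp add: comm_group_def)
  have "cobd G m k \<in> hom ((cochain_prod G m k)\<lparr>carrier := cochains G T m k\<rparr>) (cochain_prod G m (Suc k))"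
    using cobd_hom[OF G, of m k] subgroup.subset[OF subgroup_cochains[OF ts, of m k]]
    unfolding hom_def Pi_def by (simp add: subset_iff)
  then show ?thesis
    using P subgroup.subgroup_is_group[OF subgroup_cochains[OF ts] P]
    by (simp add: group_hom_def group_hom_axioms_def)
qed

text \<open>Cocycles are the kernel of the coboundary restricted to continuous cochains.\<close>

lemma subgroup_cocycles:
  assumes G: "group G" and ts: "topspace T = carrier G"
  shows "subgroup (cocycles G T m k) (cochain_prod G m k)"
proof -
  interpret comm_group "cochain_prod G m k" by (rule comm_group_cochain_prod)
  have "cocycles G T m k = kernel ((cochain_prod G m k)\<lparr>carrier := cochains G T m k\<rparr>)
      (cochain_prod G m (Suc k)) (cobd G m k)"
    by (simp add: cocycles_def kernel_def one_cochain_group)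
  then show ?thesis
    using group_hom.subgroup_kernel[OF group_hom_cobd[OF G ts, of m k]]
      incl_subgroup[OF subgroup_cochains[OF ts]] by simp
qed

lemma subgroup_coboundaries:
  assumes G: "group G" and ts: "topspace T = carrier G"
  shows "subgroup (coboundaries G T m (Suc k)) (cochain_prod G m (Suc k))"
  using group_hom.img_is_subgroup[OF group_hom_cobd[OF G ts, of m k]] by (simp add: coboundaries_def)

section \<open>Explicit formulas for cochains of degree one and two\<close>

definition tup1 :: "'a \<Rightarrow> nat \<Rightarrow> 'a" where
  "tup1 a = (\<lambda>i\<in>{..<1}. a)"

definition tup2 :: "'a \<Rightarrow> 'a \<Rightarrow> nat \<Rightarrow> 'a" where
  "tup2 a b = (\<lambda>i\<in>{..<2}. if i = 0 then a else b)"

lemma tup1_in_tuples: "a \<in> carrier G \<Longrightarrow> tup1 a \<in> tuples G 1"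
  by (simp add: tup1_def tuples_def restrict_PiE_iff)

lemma tup2_in_tuples: "a \<in> carrier G \<Longrightarrow> b \<in> carrier G \<Longrightarrow> tup2 a b \<in> tuples G 2"
  by (simp add: tup2_def tuples_def restrict_PiE_iff)

text \<open>Tuples are extensional functions, so the two entries determine the whole function,
  including its default value outside the index set.\<close>

lemma tuples2_cases:
  assumes "x \<in> tuples G 2"
  obtains a b where "a \<in> carrier G" "b \<in> carrier G" "x = tup2 a b"
proof
  show "x 0 \<in> carrier G" "x 1 \<in> carrier G" by (rule tuples_mem[OF assms], simp)+
  have "x i = tup2 (x 0) (x 1) i" for i
    using PiE_arb[OF assms[unfolded tuples_def], of i]
    by (cases "i = 0"; cases "i = 1") (simp_all add: tup2_def)
  then show "x = tup2 (x 0) (x 1)" by blast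
qed

lemma tup_nth [simp]: "tup1 a 0 = a" "tup2 a b 0 = a" "tup2 a b (Suc 0) = b"
  by (auto simp: tup1_def tup2_def)

lemma cobd_tup2:
  assumes "a \<in> carrier G" "b \<in> carrier G"
  shows "cobd G m 1 f (tup2 a b) = (f (tup1 b) - f (tup1 (a \<otimes>\<^bsub>G\<^esub> b)) + f (tup1 a)) mod int m"
proof -
  have "(\<lambda>j\<in>{..<1}. tup2 a b (Suc j)) = tup1 b" "restrict (tup2 a b) {..<1} = tup1 a"
    "merge_at G 1 0 (tup2 a b) = tup1 (a \<otimes>\<^bsub>G\<^esub> b)"
    by (auto simp: tup1_def tup2_def merge_at_def)
  moreover have "tup2 a b \<in> tuples G (Suc 1)" using tup2_in_tuples[OF assms] by (simp add: numeral_2_eq_2)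
  ultimately show ?thesis by (simp add: cobd_def)
qed

lemma cobd2_apply:
  assumes x: "x \<in> tuples G 3"
  shows "cobd G m 2 f x = (f (tup2 (x 1) (x 2)) - f (tup2 (x 0 \<otimes>\<^bsub>G\<^esub> x 1) (x 2))
    + f (tup2 (x 0) (x 1 \<otimes>\<^bsub>G\<^esub> x 2)) - f (tup2 (x 0) (x 1))) mod int m"
proof -
  have "(\<lambda>j\<in>{..<2}. x (Suc j)) = tup2 (x 1) (x 2)" "restrict x {..<2} = tup2 (x 0) (x 1)"
    "merge_at G 2 0 x = tup2 (x 0 \<otimes>\<^bsub>G\<^esub> x 1) (x 2)" "merge_at G 2 1 x = tup2 (x 0) (x 1 \<otimes>\<^bsub>G\<^esub> x 2)"
    by (auto simp: tup2_def merge_at_def fun_eq_iff restrict_def numeral_2_eq_2 less_Suc_eq)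
  moreover have "x \<in> tuples G (Suc 2)" using x by (simp add: numeral_3_eq_3 numeral_2_eq_2)
  moreover have "{..<2::nat} = {0, 1}" by auto
  ultimately show ?thesis by (simp add: cobd_def algebra_simps)
qed

text \<open>The classical identity for factor sets. Terms are distributed over both sides so that no
  signs occur, and the final reduction becomes a congruence.\<close>

lemma cocycles2_iff:
  assumes G: "group G"
  shows "f \<in> cocycles G T m 2 \<longleftrightarrow> f \<in> cochains G T m 2 \<and>
    (\<forall>a\<in>carrier G. \<forall>b\<in>carrier G. \<forall>c\<in>carrier G.
      [f (tup2 b c) + f (tup2 a (b \<otimes>\<^bsub>G\<^esub> c)) = f (tup2 (a \<otimes>\<^bsub>G\<^esub> b) c) + f (tup2 a b)] (mod int m))"
    (is "_ \<longleftrightarrow> _ \<and> ?C")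
proof -
  have cong: "[p + r = q + s] (mod int m) \<longleftrightarrow> (p - q + r - s) mod int m = 0" for p q r s
    by (simp add: cong_iff_dvd_diff mod_eq_0_iff_dvd algebra_simps)
  have "cobd G m 2 f = (\<lambda>x\<in>tuples G (Suc 2). 0) \<longleftrightarrow> (\<forall>x\<in>tuples G (Suc 2). cobd G m 2 f x = 0)"
    by (auto simp: cobd_def fun_eq_iff restrict_def)
  also have "\<dots> \<longleftrightarrow> (\<forall>x\<in>tuples G 3. cobd G m 2 f x = 0)"
    by (simp add: numeral_3_eq_3 numeral_2_eq_2)
  also have "\<dots> \<longleftrightarrow> ?C"
  proof
    assume L: "\<forall>x\<in>tuples G 3. cobd G m 2 f x = 0"
    show ?C
    proof (intro ballI)
      fix a b c assume abc: "a \<in> carrier G" "b \<in> carrier G" "c \<in> carrier G"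
      define x where "x = (\<lambda>i\<in>{..<3::nat}. if i = 0 then a else if i = 1 then b else c)"
      have x: "x \<in> tuples G 3" using abc by (simp add: x_def tuples_def restrict_PiE_iff)
      have "x 0 = a" "x 1 = b" "x 2 = c" by (auto simp: x_def)
      with L x show "[f (tup2 b c) + f (tup2 a (b \<otimes>\<^bsub>G\<^esub> c)) = f (tup2 (a \<otimes>\<^bsub>G\<^esub> b) c) + f (tup2 a b)] (mod int m)"
        using cobd2_apply[OF x, of m f] unfolding cong by simp
    qed
  next
    assume R: ?C
    show "\<forall>x\<in>tuples G 3. cobd G m 2 f x = 0"
    proof
      fix x assume x: "x \<in> tuples G 3"
      have "x 0 \<in> carrier G" "x 1 \<in> carrier G" "x 2 \<in> carrier G"
        by (rule tuples_mem[OF x], simp)+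
      then show "cobd G m 2 f x = 0"
        unfolding cobd2_apply[OF x] using R unfolding cong by blast
    qed
  qed
  finally show ?thesis by (auto simp: cocycles_def one_cochain_group)
qed

text \<open>For \<open>f = cobd G m 1 g\<close> both sides of the cocycle identity expand to g(a) +
  g(b) + g(c) - g(abc). Continuity of \<open>f\<close> holds because \<open>g\<close> is composed
  with projections and with multiplication.\<close>

lemma coboundaries2_subset_cocycles2:
  fixes G (structure)
  assumes top: "topological_group G T"
  shows "coboundaries G T m 2 \<subseteq> cocycles G T m 2"
proof
  fix f assume "f \<in> coboundaries G T m 2"
  then obtain g where g: "g \<in> cochains G T m 1" and f: "f = cobd G m 1 g"
    by (auto simp: coboundaries_def numeral_2_eq_2)
  interpret group G using top by (simp add: topological_group_def)
  have ts: "topspace T = carrier G" using top by (simp add: topological_group_def)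
  let ?X = "product_topology (\<lambda>_. T) {..<2::nat}"
  have tsX: "topspace ?X = tuples G 2" by (simp add: tuples_def ts)
  have proj: "continuous_map ?X T (\<lambda>x. x i)" if "i < 2" for i
    using that by (intro continuous_map_product_projection) auto
  have lg: "locally_constant (product_topology (\<lambda>_. T) {..<1}) g"
    using g unfolding cochains_iff[OF ts] by blast
  have lc: "locally_constant ?X (\<lambda>x. g (tup1 (p x)))" if "continuous_map ?X T p" for p
  proof (rule locally_constant_compose[OF _ lg])
    show "continuous_map ?X (product_topology (\<lambda>_. T) {..<1}) (\<lambda>x. tup1 (p x))"
      unfolding continuous_map_componentwise using that by (auto simp: tup1_def)
  qed
  have "locally_constant ?X (\<lambda>x. (g (tup1 (x 1)) - g (tup1 (x 0 \<otimes> x 1)) + g (tup1 (x 0))) mod int m)"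
    by (rule locally_constant_comp2[where h = "\<lambda>a b. (a + b) mod int m"],
        rule locally_constant_comp2[where h = "\<lambda>a b. a - b"])
       (intro lc continuous_map_topological_group_mult[OF top] proj; simp)+
  then have "locally_constant ?X f"
  proof (rule locally_constant_cong[rotated])
    fix x assume "x \<in> topspace ?X"
    then obtain a b where "a \<in> carrier G" "b \<in> carrier G" "x = tup2 a b"
      unfolding tsX by (rule tuples2_cases)
    then show "(g (tup1 (x 1)) - g (tup1 (x 0 \<otimes> x 1)) + g (tup1 (x 0))) mod int m = f x"
      unfolding f using cobd_tup2[of a G b m g] by simp
  qed
  moreover have "f \<in> tuples G 2 \<rightarrow>\<^sub>E carrier (integer_mod_group m)"
    unfolding f by (auto simp: cobd_def numeral_2_eq_2 intro: mod_in_carrier_integer_mod_group)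
  ultimately have "f \<in> cochains G T m 2" unfolding cochains_iff[OF ts] by blast
  moreover have "[f (tup2 b c) + f (tup2 a (b \<otimes> c)) = f (tup2 (a \<otimes> b) c) + f (tup2 a b)] (mod int m)"
    if abc: "a \<in> carrier G" "b \<in> carrier G" "c \<in> carrier G" for a b c
    using abc by (simp only: f cobd_tup2 m_closed cong_def mod_add_eq m_assoc) (simp add: algebra_simps)
  ultimately show "f \<in> cocycles G T m 2" unfolding cocycles2_iff[OF is_group] by blast
qed

section \<open>Cup products and the Bockstein map\<close>

abbreviation cocycle_group :: "'a monoid \<Rightarrow> 'a topology \<Rightarrow> nat \<Rightarrow> ((nat \<Rightarrow> 'a) \<Rightarrow> int) monoid" where
  "cocycle_group G T m \<equiv> (cochain_prod G m 2)\<lparr>carrier := cocycles G T m 2\<rparr>"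

lemma cohomology2_eq: "cohomology G T m 2 = cocycle_group G T m Mod coboundaries G T m 2"
  by (simp add: cohomology_def cochain_group_def)

text \<open>A coset depends only on the multiplication, which cochains and cocycles share; so
  classes can be treated as cosets in the group of cocycles, where the quotient is formed.\<close>

lemma coh_class2_eq: "coh_class G T m 2 c = coboundaries G T m 2 #>\<^bsub>cocycle_group G T m\<^esub> c"
  by (simp add: coh_class_def cochain_group_def r_coset_def)

lemma comm_group_cocycle_group:
  assumes "topological_group G T"
  shows "comm_group (cocycle_group G T m)"
proof -
  interpret P: comm_group "cochain_prod G m 2" by (rule comm_group_cochain_prod)
  have "subgroup (cocycles G T m 2) (cochain_prod G m 2)"
    using assms by (intro subgroup_cocycles) (simp_all add: topological_group_def)
  then show ?thesis
    by (intro group.group_comm_groupI P.subgroup_imp_group) (simp_all add: add.commute)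
qed

lemma normal_coboundaries2:
  assumes "topological_group G T"
  shows "coboundaries G T m 2 \<lhd> cocycle_group G T m"
proof -
  interpret P: comm_group "cochain_prod G m 2" by (rule comm_group_cochain_prod)
  interpret Z: comm_group "cocycle_group G T m" by (rule comm_group_cocycle_group[OF assms])
  have G: "group G" "topspace T = carrier G" using assms by (auto simp: topological_group_def)
  have "subgroup (coboundaries G T m 2) (cochain_prod G m 2)"
    using subgroup_coboundaries[OF G, of m 1] by (simp add: numeral_2_eq_2)
  then have "subgroup (coboundaries G T m 2) (cocycle_group G T m)"
    using subgroup_cocycles[OF G] coboundaries2_subset_cocycles2[OF assms] by (rule P.subgroup_incl)
  then show ?thesis by (rule Z.subgroup_imp_normal)
qed

lemma comm_group_cohomology2:
  assumes "topological_group G T"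
  shows "comm_group (cohomology G T m 2)"
  unfolding cohomology2_eq
  by (rule comm_group.abelian_FactGroup[OF comm_group_cocycle_group[OF assms]
        normal_imp_subgroup[OF normal_coboundaries2[OF assms]]])

lemma coh_class_hom:
  assumes "topological_group G T"
  shows "coh_class G T m 2 \<in> hom (cocycle_group G T m) (cohomology G T m 2)"
  using normal.r_coset_hom_Mod[OF normal_coboundaries2[OF assms]]
  by (simp only: coh_class2_eq[abs_def] cohomology2_eq)

lemma coh_class_self:
  assumes "topological_group G T" "c \<in> cocycles G T m 2"
  shows "c \<in> coh_class G T m 2 c"
  unfolding coh_class2_eq
  using assms comm_group_cocycle_group[OF assms(1), of m]
    normal_imp_subgroup[OF normal_coboundaries2[OF assms(1), of m]]
  by (intro group.rcos_self) (auto simp: comm_group_def)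

lemma coh_class_eq:
  assumes "topological_group G T" "c \<in> cocycles G T m 2" "d \<in> coh_class G T m 2 c"
  shows "coh_class G T m 2 d = coh_class G T m 2 c"
  using assms comm_group_cocycle_group[OF assms(1), of m]
    normal_imp_subgroup[OF normal_coboundaries2[OF assms(1), of m]]
    group.repr_independence[of "cocycle_group G T m" d "coboundaries G T m 2" c]
  unfolding coh_class2_eq by (simp add: comm_group_def)

lemma mem_coh_class2_iff:
  "d \<in> coh_class G T m 2 c \<longleftrightarrow>
    (\<exists>g\<in>cochains G T m 1. d = (\<lambda>x\<in>tuples G 2. (cobd G m 1 g x + c x) mod int m))"
  by (auto simp: coh_class_def r_coset_def mult_cochain_group coboundaries_def numeral_2_eq_2)

text \<open>Passing to classes is a homomorphism, so a finite product of classes is represented by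
  the reduced pointwise sum. The second conjunct is carried through the induction because the
  homomorphism law applies only to cocycles.\<close>

lemma finprod_coh_class:
  assumes top: "topological_group G T" and c: "\<And>i. i < r \<Longrightarrow> c i \<in> cocycles G T m 2"
  defines "C \<equiv> \<lambda>r. \<lambda>t\<in>tuples G 2. (\<Sum>i<(r::nat). c i t) mod int m"
  shows "finprod (cohomology G T m 2) (\<lambda>i. coh_class G T m 2 (c i)) {..<r} = coh_class G T m 2 (C r)
    \<and> C r \<in> cocycles G T m 2"
proof -
  interpret Z: comm_group "cocycle_group G T m" by (rule comm_group_cocycle_group[OF top])
  interpret H: comm_group "cohomology G T m 2" by (rule comm_group_cohomology2[OF top])
  interpret q: group_hom "cocycle_group G T m" "cohomology G T m 2" "coh_class G T m 2"
    using coh_class_hom[OF top] by unfold_locales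
  show ?thesis
    using c
  proof (induction r)
    case 0
    have C0: "C 0 = \<one>\<^bsub>cocycle_group G T m\<^esub>" by (auto simp: C_def)
    then show ?case using q.hom_one Z.one_closed by (simp del: one_product_group)
  next
    case (Suc r)
    have IH: "finprod (cohomology G T m 2) (\<lambda>i. coh_class G T m 2 (c i)) {..<r} = coh_class G T m 2 (C r)"
      and Cr: "C r \<in> cocycles G T m 2" using Suc by auto
    have CS: "C (Suc r) = c r \<otimes>\<^bsub>cocycle_group G T m\<^esub> C r"
      by (auto simp: C_def mod_simps add_ac intro!: restrict_ext)
    have cl: "coh_class G T m 2 (c i) \<in> carrier (cohomology G T m 2)" if "i < Suc r" for i
      using q.hom_closed Suc.prems that by simp
    have car: "c r \<in> carrier (cocycle_group G T m)" "C r \<in> carrier (cocycle_group G T m)"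
      using Suc.prems Cr by simp_all
    have "finprod (cohomology G T m 2) (\<lambda>i. coh_class G T m 2 (c i)) {..<Suc r}
        = coh_class G T m 2 (c r) \<otimes>\<^bsub>cohomology G T m 2\<^esub> coh_class G T m 2 (C r)"
      unfolding lessThan_Suc IH[symmetric] by (rule H.finprod_insert) (use cl in auto)
    also have "\<dots> = coh_class G T m 2 (C (Suc r))"
      unfolding CS by (rule q.hom_mult[OF car, symmetric])
    finally have 1: "finprod (cohomology G T m 2) (\<lambda>i. coh_class G T m 2 (c i)) {..<Suc r}
        = coh_class G T m 2 (C (Suc r))" .
    have "C (Suc r) \<in> carrier (cocycle_group G T m)" unfolding CS by (rule Z.m_closed[OF car])
    then have "C (Suc r) \<in> cocycles G T m 2" by simp
    with 1 show ?case by blast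
  qed
qed

section \<open>Cocycles representing cup products and Bockstein classes\<close>

lemma cont_hom_iff:
  assumes "topspace T = carrier G"
  shows "x \<in> cont_hom G T m \<longleftrightarrow> (\<forall>a\<in>carrier G. x a \<in> carrier (integer_mod_group m)) \<and>
    (\<forall>a\<in>carrier G. \<forall>b\<in>carrier G. x (a \<otimes>\<^bsub>G\<^esub> b) = (x a + x b) mod int m) \<and> locally_constant T x"
  using assms by (auto simp: cont_hom_def hom_def Pi_def zmod_top_def continuous_map_discrete_iff)

lemma locally_constant_proj:
  assumes "i \<in> I" "locally_constant T f"
  shows "locally_constant (product_topology (\<lambda>_. T) I) (\<lambda>t. f (t i))"
  using continuous_map_product_projection[OF assms(1), of "\<lambda>_. T"] assms(2)
  by (rule locally_constant_compose)

lemma int_div_less: "0 < k \<Longrightarrow> a < k * l \<Longrightarrow> a div k < (l::int)"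
  using mult_div_mod_eq[of k a] pos_mod_sign[of k a] mult_less_cancel_left_pos[of k "a div k" l] by linarith

text \<open>Covers both shapes in use: \<open>h\<close> is a reduced product for cup products and an
  integer quotient for carries.\<close>

lemma cochains2I:
  assumes ts: "topspace T = carrier G" and lc: "locally_constant T x" "locally_constant T y"
    and c: "\<And>a b. a \<in> carrier G \<Longrightarrow> b \<in> carrier G \<Longrightarrow> h (x a) (y b) \<in> carrier (integer_mod_group m)"
  shows "(\<lambda>t\<in>tuples G 2. h (x (t 0)) (y (t 1))) \<in> cochains G T m 2"
  unfolding cochains_iff[OF ts]
proof
  show "(\<lambda>t\<in>tuples G 2. h (x (t 0)) (y (t 1))) \<in> tuples G 2 \<rightarrow>\<^sub>E carrier (integer_mod_group m)"
    unfolding restrict_PiE_iff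
  proof
    fix t assume "t \<in> tuples G 2"
    then show "h (x (t 0)) (y (t 1)) \<in> carrier (integer_mod_group m)"
      by (intro c tuples_mem) auto
  qed
  let ?X = "product_topology (\<lambda>_. T) {..<2::nat}"
  have "locally_constant ?X (\<lambda>t. h (x (t 0)) (y (t 1)))"
    by (rule locally_constant_comp2; rule locally_constant_proj) (simp_all add: lc)
  then show "locally_constant ?X (\<lambda>t\<in>tuples G 2. h (x (t 0)) (y (t 1)))"
    by (rule locally_constant_cong[rotated]) (simp add: tuples_def ts)
qed

text \<open>By bilinearity both sides of the cocycle identity equal x(a)y(b) + x(a)y(c) + x(b)y(c)
  modulo \<open>m\<close>.\<close>

lemma cup_cocycle:
  assumes top: "topological_group G T" and x: "x \<in> cont_hom G T m" and y: "y \<in> cont_hom G T m"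
  shows "(\<lambda>t\<in>tuples G 2. (x (t 0) * y (t 1)) mod int m) \<in> cocycles G T m 2"
proof -
  interpret group G using top by (simp add: topological_group_def)
  have ts: "topspace T = carrier G" using top by (simp add: topological_group_def)
  show ?thesis
    unfolding cocycles2_iff[OF is_group]
  proof (intro conjI ballI)
    show "(\<lambda>t\<in>tuples G 2. (x (t 0) * y (t 1)) mod int m) \<in> cochains G T m 2"
      by (rule cochains2I[OF ts]) (use x y in \<open>auto simp: cont_hom_iff[OF ts] mod_in_carrier_integer_mod_group\<close>)
    fix a b c assume abc: "a \<in> carrier G" "b \<in> carrier G" "c \<in> carrier G"
    have "x (a \<otimes>\<^bsub>G\<^esub> b) = (x a + x b) mod int m" "y (b \<otimes>\<^bsub>G\<^esub> c) = (y b + y c) mod int m"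
      using x y abc by (auto simp: cont_hom_iff[OF ts])
    then show "[(\<lambda>t\<in>tuples G 2. x (t 0) * y (t 1) mod int m) (tup2 b c)
        + (\<lambda>t\<in>tuples G 2. x (t 0) * y (t 1) mod int m) (tup2 a (b \<otimes>\<^bsub>G\<^esub> c))
        = (\<lambda>t\<in>tuples G 2. x (t 0) * y (t 1) mod int m) (tup2 (a \<otimes>\<^bsub>G\<^esub> b) c)
        + (\<lambda>t\<in>tuples G 2. x (t 0) * y (t 1) mod int m) (tup2 a b)] (mod int m)"
      using abc by (simp add: tup2_in_tuples cong_def mod_simps) (simp add: algebra_simps)
  qed
qed

text \<open>For a homomorphism \<open>z\<close> with representatives in \<open>{0..<m}\<close> this
  is the carry, 0 or 1, that occurs when two residues are added.\<close>

definition bock :: "'a monoid \<Rightarrow> nat \<Rightarrow> ('a \<Rightarrow> int) \<Rightarrow> (nat \<Rightarrow> 'a) \<Rightarrow> int" where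
  "bock G m z = (\<lambda>t\<in>tuples G 2. (z (t 0) + z (t 1)) div int m)"

text \<open>Over the integers, \<open>m\<close> times the carry is the coboundary of the
  integer-valued lift of \<open>z\<close>. The cocycle identity therefore holds exactly after
  multiplication by \<open>m\<close>, and \<open>m\<close> cancels.\<close>

lemma
  assumes top: "topological_group G T" and m: "m \<ge> 1" and z: "z \<in> cont_hom G T m"
  shows bock_mult: "\<And>a b. a \<in> carrier G \<Longrightarrow> b \<in> carrier G \<Longrightarrow>
      int m * bock G m z (tup2 a b) = z a + z b - z (a \<otimes>\<^bsub>G\<^esub> b)"
    and bock_cocycle: "bock G m z \<in> cocycles G T m 2"
proof -
  interpret group G using top by (simp add: topological_group_def)
  have ts: "topspace T = carrier G" using top by (simp add: topological_group_def)
  have zr: "0 \<le> z a \<and> z a < int m" if "a \<in> carrier G" for a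
    using z that m by (auto simp: cont_hom_iff[OF ts] carrier_integer_mod_group)
  show bm: "int m * bock G m z (tup2 a b) = z a + z b - z (a \<otimes>\<^bsub>G\<^esub> b)"
    if "a \<in> carrier G" "b \<in> carrier G" for a b
    using z that by (simp add: cont_hom_iff[OF ts] bock_def tup2_in_tuples minus_mod_eq_mult_div)
  show "bock G m z \<in> cocycles G T m 2"
    unfolding cocycles2_iff[OF is_group]
  proof (intro conjI ballI)
    have "0 \<le> (z a + z b) div int m \<and> (z a + z b) div int m < int m"
      if ab: "a \<in> carrier G" "b \<in> carrier G" for a b
    proof
      show "0 \<le> (z a + z b) div int m" using zr[OF ab(1)] zr[OF ab(2)] by (simp add: pos_imp_zdiv_nonneg_iff)
      \<comment> \<open>The sum is below \<open>2 * int m\<close>, which is at most the square of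
        \<open>m\<close> once \<open>m\<close> is at least 2; for \<open>m = 1\<close> all values of
        \<open>z\<close> are 0.\<close>
      have "z a + z b < int m * int m \<or> m = 1"
      proof (cases "m = 1")
        case False
        then have "2 * int m \<le> int m * int m" using m by (intro mult_right_mono) auto
        then show ?thesis using zr[OF ab(1)] zr[OF ab(2)] by linarith
      qed simp
      then show "(z a + z b) div int m < int m"
        using zr[OF ab(1)] zr[OF ab(2)] m by (auto intro: int_div_less)
    qed
    then show "bock G m z \<in> cochains G T m 2"
      unfolding bock_def
      by (intro cochains2I[OF ts]) (use z m in \<open>auto simp: cont_hom_iff[OF ts] carrier_integer_mod_group\<close>)
    fix a b c assume abc: "a \<in> carrier G" "b \<in> carrier G" "c \<in> carrier G"
    have "int m * (bock G m z (tup2 b c) + bock G m z (tup2 a (b \<otimes>\<^bsub>G\<^esub> c)))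
        = int m * (bock G m z (tup2 (a \<otimes>\<^bsub>G\<^esub> b) c) + bock G m z (tup2 a b))"
      using abc by (simp add: distrib_left bm m_assoc)
    then show "[bock G m z (tup2 b c) + bock G m z (tup2 a (b \<otimes>\<^bsub>G\<^esub> c))
        = bock G m z (tup2 (a \<otimes>\<^bsub>G\<^esub> b) c) + bock G m z (tup2 a b)] (mod int m)"
      using m by simp
  qed
qed

lemma cochains1I:
  assumes ts: "topspace T = carrier G" and lc: "locally_constant T x"
    and c: "\<And>a. a \<in> carrier G \<Longrightarrow> x a \<in> carrier (integer_mod_group m)"
  shows "(\<lambda>t\<in>tuples G 1. x (t 0)) \<in> cochains G T m 1"
  unfolding cochains_iff[OF ts]
proof
  show "(\<lambda>t\<in>tuples G 1. x (t 0)) \<in> tuples G 1 \<rightarrow>\<^sub>E carrier (integer_mod_group m)"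
    unfolding restrict_PiE_iff
  proof
    fix t assume "t \<in> tuples G 1"
    then show "x (t 0) \<in> carrier (integer_mod_group m)"
      by (intro c tuples_mem) auto
  qed
  let ?X = "product_topology (\<lambda>_. T) {..<1::nat}"
  have "locally_constant ?X (\<lambda>t. x (t 0))"
    by (rule locally_constant_proj) (simp_all add: lc)
  then show "locally_constant ?X (\<lambda>t\<in>tuples G 1. x (t 0))"
    by (rule locally_constant_cong[rotated]) (simp add: tuples_def ts)
qed

text \<open>The representative of \<open>z\<close> in \<open>{0..<m}\<close>, read modulo the square
  of \<open>m\<close>, is an admissible lift and yields the carry cocycle. Any other lift is z + m
  v, and this changes the resulting cocycle by the coboundary of \<open>v\<close>, so the union
  consists of a single class.\<close>

lemma bockstein_eq:
  assumes top: "topological_group G T" and m: "m \<ge> 1" and z: "z \<in> cont_hom G T m"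
  shows "bockstein G T m z = coh_class G T m 2 (bock G m z)"
proof -
  interpret group G using top by (simp add: topological_group_def)
  have ts: "topspace T = carrier G" using top by (simp add: topological_group_def)
  have zc: "z a \<in> carrier (integer_mod_group m)" if "a \<in> carrier G" for a
    using z that by (simp add: cont_hom_iff[OF ts])
  have lz: "locally_constant T z" using z by (simp add: cont_hom_iff[OF ts])
  note bm = bock_mult[OF top m z] and bc = bock_cocycle[OF top m z]
  let ?P = "\<lambda>c w. w \<in> cochains G T (m ^ 2) 1 \<and> c \<in> cochains G T m 2 \<and>
          (\<forall>t\<in>tuples G 1. w t mod int m = z (t 0)) \<and>
          (\<forall>t\<in>tuples G 2. (int m * c t) mod int (m ^ 2) = cobd G (m ^ 2) 1 w t)"
  have "?P (bock G m z) (\<lambda>t\<in>tuples G 1. z (t 0))"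
  proof (intro conjI ballI)
    show "(\<lambda>t\<in>tuples G 1. z (t 0)) \<in> cochains G T (m ^ 2) 1"
    proof (rule cochains1I[OF ts lz])
      fix a assume "a \<in> carrier G"
      then have "0 \<le> z a \<and> z a < int m" using zc m by (auto simp: carrier_integer_mod_group)
      moreover have "int m * 1 \<le> int m * int m" using m by (intro mult_left_mono) auto
      ultimately have "0 \<le> z a \<and> z a < int m * int m" by linarith
      then show "z a \<in> carrier (integer_mod_group (m ^ 2))"
        by (simp add: carrier_integer_mod_group power2_eq_square)
    qed
    show "bock G m z \<in> cochains G T m 2" using bc by (simp add: cocycles_def)
    show "(\<lambda>t\<in>tuples G 1. z (t 0)) t mod int m = z (t 0)" if "t \<in> tuples G 1" for t
      using mod_carrier_integer_mod_group[OF zc[OF tuples_mem[OF that, of 0]]] that by simp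
    fix t assume "t \<in> tuples G 2"
    then obtain a b where ab: "a \<in> carrier G" "b \<in> carrier G" "t = tup2 a b" by (rule tuples2_cases)
    show "(int m * bock G m z t) mod int (m ^ 2) = cobd G (m ^ 2) 1 (\<lambda>t\<in>tuples G 1. z (t 0)) t"
      unfolding ab(3) cobd_tup2[OF ab(1,2)] bm[OF ab(1,2)]
      using ab(1,2) tup1_in_tuples[of _ G] by (simp add: algebra_simps)
  qed
  moreover have "coh_class G T m 2 c = coh_class G T m 2 (bock G m z)" if P: "?P c w" for c w
  proof (rule coh_class_eq[OF top bc])
    \<comment> \<open>The upper digit of \<open>w\<close> in base \<open>m\<close>; the lower digit
      is \<open>z\<close>. It lies in \<open>{0..<m}\<close> because \<open>w\<close> is below the
      square of \<open>m\<close>.\<close>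
    define v where "v = (\<lambda>t\<in>tuples G 1. w (tup1 (t 0)) div int m)"
    have w: "w \<in> cochains G T (m ^ 2) 1" and c: "c \<in> cochains G T m 2"
      and wz: "\<And>a. a \<in> carrier G \<Longrightarrow> w (tup1 a) mod int m = z a"
      and cw: "\<And>a b. a \<in> carrier G \<Longrightarrow> b \<in> carrier G \<Longrightarrow>
        (int m * c (tup2 a b)) mod int (m ^ 2) = cobd G (m ^ 2) 1 w (tup2 a b)"
      using P tup1_in_tuples[of _ G] tup2_in_tuples[of _ G] by auto
    have cP: "c \<in> tuples G 2 \<rightarrow>\<^sub>E carrier (integer_mod_group m)"
      using c by (simp add: cochains_def)
    have wv: "w (tup1 a) = int m * v (tup1 a) + z a" if "a \<in> carrier G" for a
      using wz[OF that] tup1_in_tuples[OF that] mult_div_mod_eq[of "int m" "w (tup1 a)"]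
      by (simp add: v_def)
    have "v \<in> cochains G T m 1"
      unfolding v_def
    proof (rule cochains1I[OF ts])
      have "continuous_map T (product_topology (\<lambda>_. T) {..<1}) tup1"
        unfolding continuous_map_componentwise by (auto simp: tup1_def)
      then have "locally_constant T (\<lambda>a. w (tup1 a))"
      proof (rule locally_constant_compose)
        show "locally_constant (product_topology (\<lambda>_. T) {..<1}) w"
          using w unfolding cochains_iff[OF ts] by blast
      qed
      then show "locally_constant T (\<lambda>a. w (tup1 a) div int m)" by (rule locally_constant_comp)
      fix a assume a: "a \<in> carrier G"
      have "w (tup1 a) \<in> carrier (integer_mod_group (m ^ 2))"
        using w tup1_in_tuples[OF a] PiE_mem unfolding cochains_iff[OF ts] by metis
      then have "0 \<le> w (tup1 a)" "w (tup1 a) < int m * int m"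
        using m by (auto simp: carrier_integer_mod_group power2_eq_square)
      then show "w (tup1 a) div int m \<in> carrier (integer_mod_group m)"
        using m by (auto simp: carrier_integer_mod_group pos_imp_zdiv_nonneg_iff intro: int_div_less)
    qed
    moreover have "c = (\<lambda>x\<in>tuples G 2. (cobd G m 1 v x + bock G m z x) mod int m)"
    proof
      fix x
      show "c x = (\<lambda>x\<in>tuples G 2. (cobd G m 1 v x + bock G m z x) mod int m) x"
      proof (cases "x \<in> tuples G 2")
        case False
        then show ?thesis using PiE_arb[OF cP] by simp
      next
        case True
        then obtain a b where ab: "a \<in> carrier G" "b \<in> carrier G" "x = tup2 a b" by (rule tuples2_cases)
        let ?d = "v (tup1 b) - v (tup1 (a \<otimes>\<^bsub>G\<^esub> b)) + v (tup1 a) + bock G m z x"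
        \<comment> \<open>The comparison is made modulo the square of \<open>m\<close>: the lower
          digits contribute \<open>m\<close> times the carry, so a common factor \<open>m\<close>
          can be cancelled to leave a congruence modulo \<open>m\<close>.\<close>
        have "[int m * c x = w (tup1 b) - w (tup1 (a \<otimes>\<^bsub>G\<^esub> b)) + w (tup1 a)] (mod int (m ^ 2))"
          using cw[OF ab(1,2)] unfolding ab(3) cobd_tup2[OF ab(1,2)] by (simp add: cong_def)
        also have "w (tup1 b) - w (tup1 (a \<otimes>\<^bsub>G\<^esub> b)) + w (tup1 a) = int m * ?d"
          using ab bm[OF ab(1,2)] by (simp add: wv algebra_simps)
        finally have "int m * int m dvd int m * (c x - ?d)"
          by (simp add: cong_iff_dvd_diff power2_eq_square right_diff_distrib)
        then have "[c x = ?d] (mod int m)" using m by (simp add: cong_iff_dvd_diff)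
        moreover have "c x mod int m = c x"
          by (rule mod_carrier_integer_mod_group[OF PiE_mem[OF cP True]])
        ultimately show ?thesis
          using True unfolding ab(3) by (simp add: cobd_tup2[OF ab(1,2), simplified] cong_def mod_add_left_eq)
      qed
    qed
    ultimately show "c \<in> coh_class G T m 2 (bock G m z)"
      unfolding mem_coh_class2_iff by blast
  qed
  ultimately show ?thesis unfolding bockstein_def by blast
qed

section \<open>The transgression\<close>

lemma coset_tup2:
  "(\<lambda>i\<in>{..<2}. K #>\<^bsub>G\<^esub> tup2 g h i) = tup2 (K #>\<^bsub>G\<^esub> g) (K #>\<^bsub>G\<^esub> h)"
  by (auto simp: tup2_def intro!: restrict_ext)

text \<open>Unwinding the spectral sequence, the inflation of \<open>c\<close> is
  \<open>\<zeta>\<close> plus the coboundaries of \<open>a\<close> and \<open>f\<close>, while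
  \<open>c0\<close> differs from \<open>c\<close> by the coboundary of \<open>b\<close>. Adding
  \<open>a\<close>, \<open>f\<close> and the inflation of \<open>b\<close> gives a cochain whose
  coboundary is the inflation of \<open>c0\<close>. The normalization of \<open>c0\<close> ensures
  that it still restricts to \<open>u\<close> modulo \<open>n\<close>.\<close>

lemma lhs_d2_transgression:
  fixes G (structure)
  assumes top: "topological_group G T" and K: "K \<lhd> G" and u1: "u \<one> = 0"
    and c0: "c0 \<in> lhs_d2 G T n K u" and c01: "[c0 (tup2 K K) = 0] (mod int n)"
  obtains F where
    "\<And>g h. g \<in> carrier G \<Longrightarrow> h \<in> carrier G \<Longrightarrow>
       [F g + F h = F (g \<otimes> h) + c0 (tup2 (K #> g) (K #> h))] (mod int n)"
    "\<And>k. k \<in> K \<Longrightarrow> [F k = u k] (mod int n)"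
proof -
  interpret normal K G by (rule K)
  let ?Q = "G Mod K" and ?TQ = "quot_topology G T K"
  have one_in: "\<one> \<in> K" by (rule subgroup.one_closed[OF subgroup_axioms])
  have S: "Suc 1 = 2" "(0::int) + 2 = 2" "(2::int) - 1 = 1" "(2::int) + 1 = 3" "(2::int) - 2 + 1 = 1"
    by simp_all
  obtain c e where cc0: "c0 \<in> coh_class ?Q ?TQ n 2 c"
    and fe: "\<forall>f\<in>e. \<forall>h\<in>K. f (\<lambda>i\<in>{..<1}. h) = u h"
    and inf: "inflation G K 2 c \<in> hs_d G T n K 2 0 1 e"
    using c0 unfolding lhs_d2_def by auto
  obtain b where b: "c0 = (\<lambda>x\<in>tuples ?Q 2. (cobd ?Q n 1 b x + c x) mod int n)"
    using cc0 unfolding mem_coh_class2_iff by blast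
  obtain B f where B: "B \<in> hs_B G T n K 2 2 2" and f: "f \<in> e"
    and Bf: "inflation G K 2 c = B \<otimes>\<^bsub>cochain_group G T n 2\<^esub> cobd G n 1 f"
    using inf unfolding hs_d_def set_mult_def S by blast
  have "hs_B G T n K 2 2 2 = hs_Z G T n K 1 3 2 <#>\<^bsub>cochain_group G T n 2\<^esub> (cobd G n 1 ` hs_Z G T n K 1 1 1)"
    unfolding hs_B_def S by (simp add: numeral_2_eq_2)
  then obtain \<zeta> a where \<zeta>: "\<zeta> \<in> hs_Z G T n K 1 3 2" and a: "a \<in> hs_Z G T n K 1 1 1"
    and Ba: "B = \<zeta> \<otimes>\<^bsub>cochain_group G T n 2\<^esub> cobd G n 1 a"
    using B unfolding set_mult_def by blast
  \<comment> \<open>Filtration degree 3 exceeds the total degree 2, where the filtration is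
    zero.\<close>
  have \<zeta>0: "\<zeta> = (\<lambda>x\<in>tuples G 2. 0)"
    using \<zeta> by (simp add: hs_Z_def hs_filtration_def one_cochain_group)
  have a_fil: "a \<in> hs_filtration G T n K 1 1" using a by (simp add: hs_Z_def)
  have ff: "((1::int) > int 1) = False" by simp
  note a_fil' = a_fil[unfolded hs_filtration_def mem_Collect_eq ff if_False]
  have a_norm: "\<forall>x\<in>tuples G 1. (\<exists>i<1. x i = \<one>) \<longrightarrow> a x = 0" using a_fil' by (elim conjE)
  have a_dep: "\<forall>x\<in>tuples G 1. \<forall>y\<in>tuples G 1. (\<forall>i<1. if i < 1 - nat 1 then x i = y i
        else K #> x i = K #> y i) \<longrightarrow> a x = a y" using a_fil' by (elim conjE)
  \<comment> \<open>In filtration degree 1 a cochain of one argument depends only on its coset, so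
    on \<open>K\<close> it takes its value at \<open>\<one>\<close>, which normalization makes
    0.\<close>
  have aK: "a (tup1 k) = 0" if k: "k \<in> K" for k
  proof -
    have kG: "tup1 k \<in> tuples G 1" "tup1 \<one> \<in> tuples G 1"
      using mem_carrier[OF k] by (simp_all only: tup1_in_tuples one_closed)
    have "K #> k = K #> \<one>" using rcos_const[OF is_group k] rcos_const[OF is_group one_in] by (simp only:)
    then have "\<forall>i<1. if i < 1 - nat 1 then tup1 k i = tup1 \<one> i else K #> tup1 k i = K #> tup1 \<one> i"
      by simp
    then have "a (tup1 k) = a (tup1 \<one>)"
      using a_dep kG by blast
    also have "\<dots> = 0" using a_norm kG(2) tup_nth(1)[of \<one>] zero_less_one by blast
    finally show ?thesis .
  qed
  txt \<open>\<open>f\<close> extends \<open>u\<close>; the inflated cochains \<open>a\<close> and \<open>b\<close> correct for the boundaries in \<open>E\<^sub>2\<^sup>2\<^sup>,\<^sup>0\<close>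
    and in \<open>H\<^sup>2(G/K)\<close>, and both vanish modulo \<open>n\<close> on \<open>K\<close>.\<close>
  define F where "F g = a (tup1 g) + f (tup1 g) + b (tup1 (K #> g))" for g
  have rel: "[F g + F h = F (g \<otimes> h) + c0 (tup2 (K #> g) (K #> h))] (mod int n)"
    if g: "g \<in> carrier G" and h: "h \<in> carrier G" for g h
  proof -
    have t: "tup2 g h \<in> tuples G 2" using g h by (rule tup2_in_tuples)
    have KQ: "K #> g \<in> carrier ?Q" "K #> h \<in> carrier ?Q"
      using g h by (auto simp: carrier_FactGroup)
    have "c (tup2 (K #> g) (K #> h)) = inflation G K 2 c (tup2 g h)"
      using t by (simp add: inflation_def coset_tup2)
    also have "\<dots> = ((a (tup1 h) - a (tup1 (g \<otimes> h)) + a (tup1 g))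
        + (f (tup1 h) - f (tup1 (g \<otimes> h)) + f (tup1 g))) mod int n"
      unfolding Bf Ba \<zeta>0 mult_cochain_group restrict_apply'[OF t] cobd_tup2[OF g h] by (simp add: mod_simps)
    finally have c: "c (tup2 (K #> g) (K #> h)) = \<dots>" .
    have "c0 (tup2 (K #> g) (K #> h)) = ((b (tup1 (K #> h)) - b (tup1 (K #> (g \<otimes> h))) + b (tup1 (K #> g)))
        + ((a (tup1 h) - a (tup1 (g \<otimes> h)) + a (tup1 g))
        + (f (tup1 h) - f (tup1 (g \<otimes> h)) + f (tup1 g)))) mod int n"
      unfolding b restrict_apply'[OF tup2_in_tuples[OF KQ]] cobd_tup2[OF KQ] c
      by (simp only: mult_FactGroup rcos_sum[OF g h] mod_add_eq)
    then show ?thesis unfolding F_def cong_def by (simp add: mod_simps) (simp add: algebra_simps)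
  qed
  have K1: "K #> \<one> = K" by (rule rcos_const[OF is_group one_in])
  have FK: "F k = u k + b (tup1 K)" if k: "k \<in> K" for k
    using aK[OF k] fe f k rcos_const[OF is_group k] by (simp add: F_def tup1_def)
  \<comment> \<open>The relation at the identity pair forces \<open>F \<one>\<close> to vanish
    modulo \<open>n\<close>; since \<open>u \<one> = 0\<close>, what remains of
    \<open>F \<one>\<close> is the constant by which \<open>F\<close> and \<open>u\<close> differ on
    \<open>K\<close>.\<close>
  have "[F \<one> + F \<one> = F \<one> + c0 (tup2 K K)] (mod int n)"
    using rel[OF one_closed one_closed] unfolding K1 r_one[OF one_closed] .
  then have "[F \<one> = c0 (tup2 K K)] (mod int n)" by (simp only: cong_add_lcancel)
  then have "[b (tup1 K) = 0] (mod int n)"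
    using c01 FK[OF one_in] u1 by (simp add: cong_def)
  then have "[F k = u k] (mod int n)" if "k \<in> K" for k
    unfolding FK[OF that] using cong_add_lcancel_0 by blast
  with rel show thesis by (rule that)
qed

text \<open>The relation is applied to (g, h), to (h, g) and to \<open>h \<otimes> g\<close> paired
  with the commutator, whose product is \<open>g \<otimes> h\<close>. In the combined differences
  the values of \<open>F\<close> at \<open>g\<close>, \<open>h\<close> and their two products
  cancel.\<close>

lemma (in group) transgression_commutator:
  fixes N :: int
  assumes rel: "\<And>g h. g \<in> carrier G \<Longrightarrow> h \<in> carrier G \<Longrightarrow> [F g + F h = F (g \<otimes> h) + \<phi> g h] (mod N)"
    and g: "g \<in> carrier G" and h: "h \<in> carrier G"
    and w: "[\<phi> (h \<otimes> g) (inv g \<otimes> inv h \<otimes> g \<otimes> h) = 0] (mod N)"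
  shows "[- F (inv g \<otimes> inv h \<otimes> g \<otimes> h) = \<phi> g h - \<phi> h g] (mod N)"
proof -
  let ?w = "inv g \<otimes> inv h \<otimes> g \<otimes> h"
  have "h \<otimes> g \<otimes> ?w = g \<otimes> h" using g h by (simp add: m_assoc r_inv_assoc)
  then have 1: "N dvd F (h \<otimes> g) + F ?w - (F (g \<otimes> h) + \<phi> (h \<otimes> g) ?w)" and 2: "N dvd \<phi> (h \<otimes> g) ?w"
    using rel[of "h \<otimes> g" ?w] w g h by (simp_all add: cong_iff_dvd_diff)
  have 3: "N dvd F g + F h - (F (g \<otimes> h) + \<phi> g h)" and 4: "N dvd F h + F g - (F (h \<otimes> g) + \<phi> h g)"
    using rel g h by (simp_all add: cong_iff_dvd_diff)
  have "N dvd (F g + F h - (F (g \<otimes> h) + \<phi> g h)) - (F h + F g - (F (h \<otimes> g) + \<phi> h g))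
      - (F (h \<otimes> g) + F ?w - (F (g \<otimes> h) + \<phi> (h \<otimes> g) ?w)) - \<phi> (h \<otimes> g) ?w"
    by (rule dvd_diff[OF dvd_diff[OF dvd_diff[OF 3 4] 1] 2])
  then show ?thesis by (simp add: cong_iff_dvd_diff algebra_simps)
qed

text \<open>The relations for the pairs (g^j, g) telescope. The term \<open>F \<one>\<close> is kept
  because it is the start of the telescope and is only later seen to vanish modulo
  \<open>N\<close>.\<close>

lemma (in group) transgression_pow:
  fixes N :: int
  assumes rel: "\<And>g h. g \<in> carrier G \<Longrightarrow> h \<in> carrier G \<Longrightarrow> [F g + F h = F (g \<otimes> h) + \<phi> g h] (mod N)"
    and g: "g \<in> carrier G"
  shows "[int k * F g + F \<one> - F (g [^] k) = (\<Sum>j<k. \<phi> (g [^] j) g)] (mod N)"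
proof (induction k)
  case (Suc k)
  have "[F (g [^] k) + F g - F (g [^] Suc k) = \<phi> (g [^] k) g] (mod N)"
    using rel[of "g [^] k" g] g by (simp add: cong_iff_dvd_diff algebra_simps)
  from cong_add[OF Suc this] show ?case by (simp add: algebra_simps)
qed simp

section \<open>Values on cosets and sums along powers\<close>

lemma sum_lessThan_choose_two: "(\<Sum>j<n. int j) = int (n choose 2)"
  by (induction n) (simp_all add: numeral_2_eq_2)

text \<open>Since \<open>u\<close> vanishes on \<open>N\<close>, it is constant on the coset, and
  its image there is the singleton that \<open>the_elem\<close> expects.\<close>

lemma on_coset_eq:
  fixes G (structure)
  assumes K: "subgroup K G" and N: "subgroup N G" "N \<subseteq> {k \<in> K. u k = 0}" and G: "group G"
    and u: "u \<in> inv_hom G T m K" and w: "w \<in> K"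
  shows "on_coset u (N #> w) = u w"
proof -
  have hom: "u \<in> hom (G\<lparr>carrier := K\<rparr>) (integer_mod_group m)" using u by (simp add: inv_hom_def cont_hom_def)
  have "u (a \<otimes> w) = u w" if a: "a \<in> N" for a
  proof -
    have "u (a \<otimes> w) = (u a + u w) mod int m" using hom_mult[OF hom, of a w] a N(2) w by auto
    moreover have "u w \<in> carrier (integer_mod_group m)" using hom_in_carrier[OF hom, of w] w by simp
    ultimately show ?thesis using a N(2) by (auto simp: mod_carrier_integer_mod_group)
  qed
  moreover have "\<one> \<in> N" using N(1) by (rule subgroup.one_closed)
  ultimately have "u ` (N #> w) = {u w}" by (auto simp: r_coset_def image_iff)
  then show ?thesis by (simp add: on_coset_def)
qed

lemma
  assumes top: "topological_group G T" and z: "z \<in> cont_hom G T m"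
  shows cont_hom_one: "z \<one>\<^bsub>G\<^esub> = 0"
    and cont_hom_pow: "\<And>g k. g \<in> carrier G \<Longrightarrow> z (g [^]\<^bsub>G\<^esub> (k::nat)) = (int k * z g) mod int m"
proof -
  have "group_hom G (integer_mod_group m) z"
    using assms by (simp add: group_hom_def group_hom_axioms_def topological_group_def cont_hom_def)
  then show "z \<one>\<^bsub>G\<^esub> = 0"
    "\<And>g k. g \<in> carrier G \<Longrightarrow> z (g [^]\<^bsub>G\<^esub> (k::nat)) = (int k * z g) mod int m"
    using group_hom.hom_one[of G "integer_mod_group m" z]
      group_hom.hom_nat_pow[of G "integer_mod_group m" z] by simp_all
qed

lemma bock_right_one:
  assumes "topological_group G T" "m \<ge> 1" "z \<in> cont_hom G T m" "a \<in> carrier G"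
  shows "bock G m z (tup2 a \<one>\<^bsub>G\<^esub>) = 0"
proof -
  interpret group G using assms(1) by (simp add: topological_group_def)
  have "int m * bock G m z (tup2 a \<one>\<^bsub>G\<^esub>) = 0"
    using bock_mult[OF assms(1-4) one_closed] cont_hom_one[OF assms(1,3)] assms(4) by simp
  then show ?thesis using assms(2) by simp
qed

lemma bock_commute:
  "a \<in> carrier G \<Longrightarrow> b \<in> carrier G \<Longrightarrow> bock G m z (tup2 a b) = bock G m z (tup2 b a)"
  by (simp add: bock_def tup2_in_tuples add.commute)

text \<open>After multiplication by \<open>m\<close> the sum telescopes to z(1) - z(g^m) + m z(g),
  and the first two terms are 0. The result is an equality of integers, not just a
  congruence.\<close>

lemma sum_bock_pow:
  assumes top: "topological_group G T" and m: "m \<ge> 1" and z: "z \<in> cont_hom G T m"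
    and g: "g \<in> carrier G"
  shows "(\<Sum>j<m. bock G m z (tup2 (g [^]\<^bsub>G\<^esub> j) g)) = z g"
proof -
  interpret group G using top by (simp add: topological_group_def)
  have "int m * (\<Sum>j<m. bock G m z (tup2 (g [^]\<^bsub>G\<^esub> j) g))
      = (\<Sum>j<m. z (g [^]\<^bsub>G\<^esub> j) - z (g [^]\<^bsub>G\<^esub> Suc j) + z g)"
    unfolding sum_distrib_left by (rule sum.cong) (use g in \<open>simp_all add: bock_mult[OF top m z]\<close>)
  also have "\<dots> = z (g [^]\<^bsub>G\<^esub> (0::nat)) - z (g [^]\<^bsub>G\<^esub> m) + int m * z g"
    using sum_lessThan_telescope'[of "\<lambda>j. z (g [^]\<^bsub>G\<^esub> j)" m] by (simp add: sum.distrib)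
  also have "\<dots> = int m * z g"
    using cont_hom_pow[OF top z g, of m] cont_hom_one[OF top z] by simp
  finally show ?thesis using m by simp
qed

section \<open>An explicit cocycle for \<eta> and its values on commutators and powers\<close>

theorem theorem2p3:
  fixes G :: "'a monoid" and T :: "'a topology" and n :: nat
    and I :: "'i set" and u :: "'a \<Rightarrow> int"
    and \<eta> :: "((nat \<Rightarrow> 'a set) \<Rightarrow> int) set"
    and r s :: nat and x y z :: "nat \<Rightarrow> 'a set \<Rightarrow> int"
  assumes n: "n \<ge> 1"
    and G: "profinite_group G T"
    and gr1: "iso_to_power (gr1 G T n) (gr1_top G T n) n I"
    and u: "u \<in> inv_hom G T n (nseries G T n 2)"
    and eta: "\<eta> = lhs_d2 G T n (nseries G T n 2) u"
    and x: "\<And>i. i < r \<Longrightarrow> x i \<in> cont_hom (gr1 G T n) (gr1_top G T n) n"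
    and y: "\<And>i. i < r \<Longrightarrow> y i \<in> cont_hom (gr1 G T n) (gr1_top G T n) n"
    and z: "\<And>j. j < s \<Longrightarrow> z j \<in> cont_hom (gr1 G T n) (gr1_top G T n) n"
    and eta_sum: "\<eta> =
      finprod (cohomology (gr1 G T n) (gr1_top G T n) n 2)
        (\<lambda>i. cup11 (gr1 G T n) (gr1_top G T n) n (x i) (y i)) {..<r}
      \<otimes>\<^bsub>cohomology (gr1 G T n) (gr1_top G T n) n 2\<^esub>
      finprod (cohomology (gr1 G T n) (gr1_top G T n) n 2)
        (\<lambda>j. bockstein (gr1 G T n) (gr1_top G T n) n (z j)) {..<s}"
  shows "\<forall>\<sigma>\<in>carrier (gr1 G T n). \<forall>\<tau>\<in>carrier (gr1 G T n).
      [- on_coset u (gr_bracket G T n \<sigma> \<tau>)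
         = (\<Sum>i<r. x i \<sigma> * y i \<tau> - y i \<sigma> * x i \<tau>)] (mod int n) \<and>
      [- on_coset u (gr_pi G T n \<sigma>)
         = int (n choose 2) * (\<Sum>i<r. x i \<sigma> * y i \<sigma>) + (\<Sum>j<s. z j \<sigma>)] (mod int n)"
proof -
  have top: "topological_group G T" using G by (simp add: profinite_group_def)
  interpret group G using top by (simp add: topological_group_def)
  define K where "K = nseries G T n 2"
  define N where "N = nseries G T n 3"
  define Q where "Q = gr1 G T n"
  define TQ where "TQ = gr1_top G T n"
  have K_nor: "K \<lhd> G" and K_clo: "closedin T K"
    unfolding K_def numeral_2_eq_2 by (rule normal_nseries[OF top], rule closedin_nseries[OF top])
  have N_nor: "N \<lhd> G" unfolding N_def numeral_3_eq_3 by (rule normal_nseries[OF top])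
  have K_eq: "K = nseries_step G T n (carrier G)"
    using nseries_Suc[of 1 G T n] by (simp add: K_def numeral_2_eq_2 nseries_def)
  have N_eq: "N = nseries_step G T n K"
    using nseries_Suc[of 2 G T n] by (simp add: N_def K_def numeral_3_eq_3)
  have uK: "u \<in> inv_hom G T n K" using u by (simp only: K_def)
  have N_ker: "N \<subseteq> {k \<in> K. u k = 0}"
    unfolding N_eq by (rule inv_hom_vanishes_nseries_step[OF top K_nor K_clo uK])
  interpret K: normal K G by (rule K_nor)
  have Q_eq: "Q = G Mod K" by (simp add: Q_def gr1_def K_def)
  have topQ: "topological_group Q TQ"
    using topological_group_quot[OF top K_nor] by (simp add: Q_def TQ_def gr1_def gr1_top_def K_def)
  have xQ: "x i \<in> cont_hom Q TQ n" and yQ: "y i \<in> cont_hom Q TQ n" if "i < r" for i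
    using x y that by (simp_all only: Q_def TQ_def)
  have zQ: "z j \<in> cont_hom Q TQ n" if "j < s" for j
    using z that by (simp only: Q_def TQ_def)
  let ?H = "cohomology Q TQ n 2" and ?cl = "coh_class Q TQ n 2"
  interpret Z: comm_group "cocycle_group Q TQ n" by (rule comm_group_cocycle_group[OF topQ])
  interpret H: comm_group ?H by (rule comm_group_cohomology2[OF topQ])
  interpret q: group_hom "cocycle_group Q TQ n" ?H ?cl
    using coh_class_hom[OF topQ] by unfold_locales

  define cup where "cup i = (\<lambda>t\<in>tuples Q 2. (x i (t 0) * y i (t 1)) mod int n)" for i
  define C1 where "C1 = (\<lambda>t\<in>tuples Q 2. (\<Sum>i<r. cup i t) mod int n)"
  define C2 where "C2 = (\<lambda>t\<in>tuples Q 2. (\<Sum>j<s. bock Q n (z j) t) mod int n)"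
  define c0 where "c0 = C1 \<otimes>\<^bsub>cocycle_group Q TQ n\<^esub> C2"
  have "cup i \<in> cocycles Q TQ n 2" if "i < r" for i
    unfolding cup_def by (rule cup_cocycle[OF topQ xQ[OF that] yQ[OF that]])
  from finprod_coh_class[OF topQ this]
  have C1: "finprod ?H (\<lambda>i. cup11 Q TQ n (x i) (y i)) {..<r} = ?cl C1" "C1 \<in> cocycles Q TQ n 2"
    by (simp_all only: C1_def cup11_def cup_def)
  have bc: "bock Q n (z j) \<in> cocycles Q TQ n 2" if "j < s" for j
    by (rule bock_cocycle[OF topQ n zQ[OF that]])
  have "finprod ?H (\<lambda>j. bockstein Q TQ n (z j)) {..<s} = finprod ?H (\<lambda>j. ?cl (bock Q n (z j))) {..<s}"
  proof (rule H.finprod_cong')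
    show "(\<lambda>j. ?cl (bock Q n (z j))) \<in> {..<s} \<rightarrow> carrier ?H"
      using bc q.hom_closed by simp
    show "bockstein Q TQ n (z j) = ?cl (bock Q n (z j))" if "j \<in> {..<s}" for j
      using that by (intro bockstein_eq[OF topQ n zQ]) simp
  qed simp
  then have C2: "finprod ?H (\<lambda>j. bockstein Q TQ n (z j)) {..<s} = ?cl C2" "C2 \<in> cocycles Q TQ n 2"
    using finprod_coh_class[OF topQ bc] by (simp_all only: C2_def)
  have car: "C1 \<in> carrier (cocycle_group Q TQ n)" "C2 \<in> carrier (cocycle_group Q TQ n)"
    using C1(2) C2(2) by simp_all
  have "\<eta> = ?cl C1 \<otimes>\<^bsub>?H\<^esub> ?cl C2"
    using eta_sum C1(1) C2(1) by (simp only: Q_def TQ_def)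
  then have "\<eta> = ?cl c0" unfolding c0_def by (simp only: q.hom_mult[OF car])
  moreover have "c0 \<in> carrier (cocycle_group Q TQ n)"
    unfolding c0_def by (rule Z.m_closed[OF car])
  then have "c0 \<in> cocycles Q TQ n 2" by simp
  \<comment> \<open>The equality of classes enters the rest of the argument only through this
    membership: the explicit cocycle is an element of the class given by the differential.\<close>
  ultimately have "c0 \<in> \<eta>" using coh_class_self[OF topQ] by blast
  then have c0_mem: "c0 \<in> lhs_d2 G T n K u" unfolding eta K_def .

  \<comment> \<open>The integer-valued form of \<open>c0\<close>, before any reduction modulo
    \<open>n\<close>, so that ordinary sums can be rearranged.\<close>
  define \<phi> where "\<phi> A B = (\<Sum>i<r. x i A * y i B) + (\<Sum>j<s. bock Q n (z j) (tup2 A B))" for A B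
  have c0_cong: "[c0 (tup2 A B) = \<phi> A B] (mod int n)" if "A \<in> carrier Q" "B \<in> carrier Q" for A B
    using tup2_in_tuples[OF that]
    by (simp add: c0_def C1_def C2_def cup_def \<phi>_def cong_def mod_simps)
  \<comment> \<open>Normalization in the second argument serves twice: at the identity pair, as the
    transgression requires, and at a commutator, whose coset is trivial.\<close>
  have \<phi>_one: "\<phi> A \<one>\<^bsub>Q\<^esub> = 0" if "A \<in> carrier Q" for A
    using cont_hom_one[OF topQ yQ] bock_right_one[OF topQ n zQ that] by (simp add: \<phi>_def)
  have cosetQ: "K #>\<^bsub>G\<^esub> g \<in> carrier Q" if "g \<in> carrier G" for g
    using that unfolding Q_eq carrier_FactGroup by (rule imageI)
  have oneQ: "\<one>\<^bsub>Q\<^esub> = K" by (simp add: Q_eq)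
  have groupQ: "group Q" using topQ by (simp add: topological_group_def)
  have "[c0 (tup2 K K) = 0] (mod int n)"
    using c0_cong[of K K] \<phi>_one[of K] group.is_monoid[OF groupQ, THEN monoid.one_closed] unfolding oneQ by simp
  moreover have u1: "u \<one>\<^bsub>G\<^esub> = 0"
    using N_ker subgroup.one_closed[OF normal_imp_subgroup[OF N_nor]] by blast
  ultimately obtain F where
    F: "\<And>g h. g \<in> carrier G \<Longrightarrow> h \<in> carrier G \<Longrightarrow>
       [F g + F h = F (g \<otimes>\<^bsub>G\<^esub> h) + c0 (tup2 (K #>\<^bsub>G\<^esub> g) (K #>\<^bsub>G\<^esub> h))] (mod int n)"
    and FK: "\<And>k. k \<in> K \<Longrightarrow> [F k = u k] (mod int n)"
    using lhs_d2_transgression[OF top K_nor _ c0_mem] by blast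
  have rel: "[F g + F h = F (g \<otimes>\<^bsub>G\<^esub> h) + \<phi> (K #>\<^bsub>G\<^esub> g) (K #>\<^bsub>G\<^esub> h)] (mod int n)"
    if "g \<in> carrier G" "h \<in> carrier G" for g h
    using F[OF that] cong_add[OF cong_refl c0_cong[OF cosetQ[OF that(1)] cosetQ[OF that(2)]]]
    by (rule cong_trans)
  have on_coset: "on_coset u (N #>\<^bsub>G\<^esub> w) = u w" if "w \<in> K" for w
    using K.subgroup_axioms normal_imp_subgroup[OF N_nor] N_ker is_group uK that by (rule on_coset_eq)

  show ?thesis
    unfolding Q_def[symmetric]
  proof (intro ballI conjI)
    fix \<sigma> \<tau> assume "\<sigma> \<in> carrier Q" "\<tau> \<in> carrier Q"
    then obtain g h where g: "g \<in> carrier G" "\<sigma> = K #>\<^bsub>G\<^esub> g" and h: "h \<in> carrier G" "\<tau> = K #>\<^bsub>G\<^esub> h"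
      unfolding Q_eq carrier_FactGroup by blast
    have \<sigma>: "\<sigma> \<in> carrier Q" and \<tau>: "\<tau> \<in> carrier Q" by fact+
    let ?w = "inv\<^bsub>G\<^esub> g \<otimes>\<^bsub>G\<^esub> inv\<^bsub>G\<^esub> h \<otimes>\<^bsub>G\<^esub> g \<otimes>\<^bsub>G\<^esub> h"
    have w: "?w \<in> K" unfolding K_eq by (rule nseries_step_gens(1)[OF top subset_refl g(1) h(1)])
    have "\<phi> (K #>\<^bsub>G\<^esub> (h \<otimes>\<^bsub>G\<^esub> g)) (K #>\<^bsub>G\<^esub> ?w) = 0"
      using \<phi>_one[OF cosetQ[OF m_closed[OF h(1) g(1)]]] unfolding K.rcos_const[OF is_group w] oneQ .
    then have "[- F ?w = \<phi> \<sigma> \<tau> - \<phi> \<tau> \<sigma>] (mod int n)"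
      unfolding g(2) h(2)
      by (intro transgression_commutator[where \<phi> = "\<lambda>g h. \<phi> (K #>\<^bsub>G\<^esub> g) (K #>\<^bsub>G\<^esub> h)"] rel g h) simp_all
    \<comment> \<open>The carries are symmetric in their arguments and drop out, so only the cup
      products are seen by the bracket.\<close>
    moreover have "\<phi> \<sigma> \<tau> - \<phi> \<tau> \<sigma> = (\<Sum>i<r. x i \<sigma> * y i \<tau> - y i \<sigma> * x i \<tau>)"
      by (simp add: \<phi>_def bock_commute[OF \<sigma> \<tau>] sum_subtractf mult.commute)
    moreover have "[- u ?w = - F ?w] (mod int n)"
      using FK[OF w] by (simp add: cong_minus_minus_iff cong_sym)
    moreover have "on_coset u (gr_bracket G T n \<sigma> \<tau>) = u ?w"
      using gr_bracket_coset[OF top g(1) h(1), of n] on_coset[OF w] by (simp add: g(2) h(2) K_def N_def)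
    ultimately show "[- on_coset u (gr_bracket G T n \<sigma> \<tau>)
         = (\<Sum>i<r. x i \<sigma> * y i \<tau> - y i \<sigma> * x i \<tau>)] (mod int n)"
      by (metis cong_trans)

    let ?w = "g [^]\<^bsub>G\<^esub> n"
    have w: "?w \<in> K" unfolding K_eq by (rule nseries_step_gens(2)[OF top subset_refl g(1)])
    have pow: "K #>\<^bsub>G\<^esub> (g [^]\<^bsub>G\<^esub> j) = \<sigma> [^]\<^bsub>Q\<^esub> j" for j :: nat
      unfolding g(2) Q_eq by (rule K.FactGroup_pow[OF g(1), symmetric])
    have F_sum: "[int n * F g + F \<one>\<^bsub>G\<^esub> - F ?w = (\<Sum>j<n. \<phi> (\<sigma> [^]\<^bsub>Q\<^esub> j) \<sigma>)] (mod int n)"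
      using transgression_pow[where \<phi> = "\<lambda>g h. \<phi> (K #>\<^bsub>G\<^esub> g) (K #>\<^bsub>G\<^esub> h)", OF rel g(1)]
      unfolding pow g(2)[symmetric] .
    \<comment> \<open>Modulo \<open>n\<close>, the multiple \<open>int n * F g\<close> vanishes, and
      \<open>F\<close> agrees with \<open>u\<close> at \<open>\<one>\<close> and at the
      \<open>n\<close>-th power, both of which lie in \<open>K\<close>.\<close>
    have F_u: "[int n * F g + F \<one>\<^bsub>G\<^esub> - F ?w = 0 + 0 - u ?w] (mod int n)"
    proof (intro cong_diff cong_add)
      show "[F \<one>\<^bsub>G\<^esub> = 0] (mod int n)"
        using FK[OF subgroup.one_closed[OF K.subgroup_axioms]] unfolding u1 .
    qed (use FK[OF w] in \<open>simp_all add: cong_0_iff\<close>)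
    have 1: "[- u ?w = (\<Sum>j<n. \<phi> (\<sigma> [^]\<^bsub>Q\<^esub> j) \<sigma>)] (mod int n)"
      using cong_trans[OF cong_sym[OF F_u] F_sum] by simp
    \<comment> \<open>Exchanging the sums isolates, for each cup product and each carry cocycle, its
      sum along the powers of \<sigma>.\<close>
    have "(\<Sum>j<n. \<phi> (\<sigma> [^]\<^bsub>Q\<^esub> j) \<sigma>) = (\<Sum>i<r. \<Sum>j<n. x i (\<sigma> [^]\<^bsub>Q\<^esub> j) * y i \<sigma>)
        + (\<Sum>l<s. \<Sum>j<n. bock Q n (z l) (tup2 (\<sigma> [^]\<^bsub>Q\<^esub> j) \<sigma>))"
      unfolding \<phi>_def sum.distrib by (simp only: sum.swap[of _ "{..<n}"])
    also have "(\<Sum>l<s. \<Sum>j<n. bock Q n (z l) (tup2 (\<sigma> [^]\<^bsub>Q\<^esub> j) \<sigma>)) = (\<Sum>l<s. z l \<sigma>)"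
      using sum_bock_pow[OF topQ n zQ \<sigma>] by simp
    finally have 2: "(\<Sum>j<n. \<phi> (\<sigma> [^]\<^bsub>Q\<^esub> j) \<sigma>)
        = (\<Sum>i<r. \<Sum>j<n. x i (\<sigma> [^]\<^bsub>Q\<^esub> j) * y i \<sigma>) + (\<Sum>l<s. z l \<sigma>)" .
    \<comment> \<open>Values of \<open>x i\<close> are reduced residues, so additivity along powers
      holds only modulo \<open>n\<close>; the factors \<open>int j\<close> then sum to the binomial
      coefficient.\<close>
    have "[(\<Sum>i<r. \<Sum>j<n. x i (\<sigma> [^]\<^bsub>Q\<^esub> j) * y i \<sigma>) = (\<Sum>i<r. \<Sum>j<n. (int j * x i \<sigma>) * y i \<sigma>)] (mod int n)"
    proof (intro cong_sum cong_mult cong_refl)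
      fix i j assume "i \<in> {..<r}"
      then show "[x i (\<sigma> [^]\<^bsub>Q\<^esub> j) = int j * x i \<sigma>] (mod int n)"
        using cont_hom_pow[OF topQ xQ \<sigma>, of i j] by simp
    qed
    moreover have "(\<Sum>i<r. \<Sum>j<n. (int j * x i \<sigma>) * y i \<sigma>) = int (n choose 2) * (\<Sum>i<r. x i \<sigma> * y i \<sigma>)"
      by (simp only: mult.assoc sum_distrib_right[symmetric] sum_lessThan_choose_two sum_distrib_left)
    ultimately have "[(\<Sum>j<n. \<phi> (\<sigma> [^]\<^bsub>Q\<^esub> j) \<sigma>)
        = int (n choose 2) * (\<Sum>i<r. x i \<sigma> * y i \<sigma>) + (\<Sum>j<s. z j \<sigma>)] (mod int n)"
      unfolding 2 by (intro cong_add) simp_all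
    moreover have "on_coset u (gr_pi G T n \<sigma>) = u ?w"
      using gr_pi_coset[OF top g(1), of n] on_coset[OF w] by (simp add: g(2) K_def N_def)
    ultimately show "[- on_coset u (gr_pi G T n \<sigma>)
         = int (n choose 2) * (\<Sum>i<r. x i \<sigma> * y i \<sigma>) + (\<Sum>j<s. z j \<sigma>)] (mod int n)"
      using cong_trans[OF 1] by simp
  qed
qed

end
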